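(* Let $(\Omega,d,\mu)$ be a metric space equipped with a separable Borel probability measure $\mu$, and let $I=I_{(\Omega,d,\mu)}:[0,1]\to[0,\infty)$ be its isoperimetric profile. Suppose that $I$ is concave, continuous, increasing on $(0,1/2)$ and symmetric about the point $1/2$. Then the following statements hold (and in fact are equivalent): (i) For all $f\in Lip(\Omega)$, $$\int_{0}^{\infty} I(\lambda_{f}(s))\,ds\le\int_{\Omega}|\nabla f(x)|\,d\mu(x).$$ (ii) For all $f\in Lip(\Omega)$, for almost every $s\in(0,1)$, $$(-f^{\ast})'(s)\,I(s)\le\frac{d}{ds}\int_{\{|f|>f^{\ast}(s)\}}|\nabla f(x)|\,d\mu(x).$$ (iii) For all $f\in Lip(\Omega)$ and all $t\in(0,1)$, $$\int_{0}^{t}\big((-f^{\ast})'(\cdot)\,I(\cdot)\big)^{\ast}(s)\,ds\le\int_{0}^{t}|\nabla f|^{\ast}(s)\,ds,$$ where the rearrangement on the left-hand side is taken with respect to Lebesgue measure on $(0,1)$, and the rearrangements $f^{\ast}$ and $|\nabla f|^{\ast}$ are taken with respect to $\mu$. (iv) For all $f\in Lip(\Omega)$ and all $t\in(0,1)$, $$f^{\ast\ast}(t)-f^{\ast}(t)\le\frac{t}{I(t)}\,|\nabla f|^{\ast\ast}(t).$$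
   Context: For a measurable function $u:\Omega\to\mathbb{R}$, the distribution function is $\lambda_u(t)=\mu(\{x\in\Omega:|u(x)|>t\})$ for $t>0$; the decreasing rearrangement is $u^{\ast}(s)=\inf\{t\ge 0:\lambda_u(t)\le s\}$ for $s\in(0,1)$; and $u^{\ast\ast}(t)=\frac1t\int_0^t u^{\ast}(s)\,ds$. Except where indicated otherwise, rearrangements are with respect to $\mu$. The rearrangement of a function on $(0,1)$ with respect to Lebesgue measure is defined in the same way with Lebesgue measure in place of $\mu$. For a Borel set $A\subset\Omega$, $Per(A)=\liminf_{\varepsilon\to0}\frac{\mu(A_{\varepsilon,d})-\mu(A)}{\varepsilon}$, where $A_{\varepsilon,d}=\{x\in\Omega:\exists\,y\in A,\ d(x,y)<\varepsilon\}$ is the $\varepsilon$-extension of $A$ with respect to $d$. The isoperimetric profile $I=I_{(\Omega,d,\mu)}$ is the pointwise maximal function $I:[0,1]\to[0,\infty)$ such that $Per(A)\ge I(\mu(A))$ for all Borel sets $A$. $Lip(\Omega)$ denotes the set of Lipschitz functions $f:\Omega\to\mathbb{R}$, and for $f\in Lip(\Omega)$ the modulus of the gradient is $|\nabla f(x)|=\limsup_{d(x,y)\to0}\frac{|f(x)-f(y)|}{d(x,y)}$. $(-f^{\ast})'(s)$ denotes $-\frac{d}{ds}f^{\ast}(s)$. *)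

theory Defs
  imports "HOL-Probability.Probability"
begin

(* The metric space is the whole type; a Borel measure on it is M with sets M = sets borel. *)

definition separable_measure :: "'a::metric_space measure \<Rightarrow> bool" where
  "separable_measure M \<longleftrightarrow>
     (\<exists>S\<in>sets M. separable_space (top_of_set S) \<and> emeasure M S = emeasure M (space M))"

definition distr_fun :: "'a measure \<Rightarrow> ('a \<Rightarrow> real) \<Rightarrow> real \<Rightarrow> real" where
  "distr_fun M u t = measure M {x \<in> space M. \<bar>u x\<bar> > t}"

(* For a measurable u on a finite measure space and s > 0 the infimum is over a nonempty set,
   so it is a genuine real infimum. *)
definition rearr :: "'a measure \<Rightarrow> ('a \<Rightarrow> real) \<Rightarrow> real \<Rightarrow> real" where
  "rearr M u s = Inf {t. 0 \<le> t \<and> distr_fun M u t \<le> s}"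

(* Extended-valued, since u need not be integrable a priori. *)
definition rearr_avg :: "'a measure \<Rightarrow> ('a \<Rightarrow> real) \<Rightarrow> real \<Rightarrow> ennreal" where
  "rearr_avg M u t = (\<integral>\<^sup>+ s\<in>{0<..<t}. ennreal (rearr M u s) \<partial>lborel) / ennreal t"

definition extension :: "real \<Rightarrow> 'a::metric_space set \<Rightarrow> 'a set" where
  "extension \<epsilon> A = {x. \<exists>y\<in>A. dist x y < \<epsilon>}"

definition Per :: "'a::metric_space measure \<Rightarrow> 'a set \<Rightarrow> ereal" where
  "Per M A = Liminf (at_right 0) (\<lambda>\<epsilon>. ereal ((measure M (extension \<epsilon> A) - measure M A) / \<epsilon>))"

definition isoperimetric_minorant :: "'a::metric_space measure \<Rightarrow> (real \<Rightarrow> real) \<Rightarrow> bool" where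
  "isoperimetric_minorant M J \<longleftrightarrow>
     (\<forall>t\<in>{0..1}. 0 \<le> J t) \<and> (\<forall>A\<in>sets borel. ereal (J (measure M A)) \<le> Per M A)"

definition is_isoperimetric_profile :: "'a::metric_space measure \<Rightarrow> (real \<Rightarrow> real) \<Rightarrow> bool" where
  "is_isoperimetric_profile M I \<longleftrightarrow>
     isoperimetric_minorant M I \<and>
     (\<forall>J. isoperimetric_minorant M J \<longrightarrow> (\<forall>t\<in>{0..1}. J t \<le> I t))"

definition Lip :: "('a::metric_space \<Rightarrow> real) set" where
  "Lip = {f. \<exists>C. C-lipschitz_on UNIV f}"

(* The upper limit is taken in ennreal so that it is 0 at isolated points, where the filter
   at x is trivial; for Lipschitz f it is bounded by the Lipschitz constant, so enn2real
   does not change its value. *)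
definition grad_mod :: "('a::metric_space \<Rightarrow> real) \<Rightarrow> 'a \<Rightarrow> real" where
  "grad_mod f x = enn2real (Limsup (at x) (\<lambda>y. ennreal (\<bar>f x - f y\<bar> / dist x y)))"

definition coarea_ineq :: "'a::metric_space measure \<Rightarrow> (real \<Rightarrow> real) \<Rightarrow> bool" where
  "coarea_ineq M I \<longleftrightarrow>
     (\<forall>f\<in>Lip. (\<integral>\<^sup>+ s\<in>{0<..}. ennreal (I (distr_fun M f s)) \<partial>lborel)
               \<le> (\<integral>\<^sup>+ x. ennreal (grad_mod f x) \<partial>M))"

definition derivative_ineq :: "'a::metric_space measure \<Rightarrow> (real \<Rightarrow> real) \<Rightarrow> bool" where
  "derivative_ineq M I \<longleftrightarrow>
     (\<forall>f\<in>Lip. AE s in lborel. s \<in> {0<..<1} \<longrightarrow>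
        (let \<Phi> = (\<lambda>r. LINT x:{x. \<bar>f x\<bar> > rearr M f r}|M. grad_mod f x) in
           rearr M f differentiable (at s) \<and> \<Phi> differentiable (at s) \<and>
           - deriv (rearr M f) s * I s \<le> deriv \<Phi> s))"

(* rearr M f is monotone on (0,1), hence differentiable almost everywhere there; the values
   of deriv at the remaining points do not affect the rearrangement on the left. *)
definition rearrangement_ineq :: "'a::metric_space measure \<Rightarrow> (real \<Rightarrow> real) \<Rightarrow> bool" where
  "rearrangement_ineq M I \<longleftrightarrow>
     (\<forall>f\<in>Lip. \<forall>t\<in>{0<..<1}.
        (\<integral>\<^sup>+ s\<in>{0<..<t}.
           ennreal (rearr (lebesgue_on {0<..<1}) (\<lambda>r. - deriv (rearr M f) r * I r) s) \<partial>lborel)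
        \<le> (\<integral>\<^sup>+ s\<in>{0<..<t}. ennreal (rearr M (grad_mod f) s) \<partial>lborel))"

(* Where I t = 0 the factor t / I t is read as infinity and the inequality is void; division
   by zero in HOL would give 0 instead. This concerns only the case I = 0 identically, because
   a concave profile that vanishes at one interior point vanishes everywhere. The truncated
   subtraction of ennreal is harmless since the right-hand side is nonnegative. *)
definition oscillation_ineq :: "'a::metric_space measure \<Rightarrow> (real \<Rightarrow> real) \<Rightarrow> bool" where
  "oscillation_ineq M I \<longleftrightarrow>
     (\<forall>f\<in>Lip. \<forall>t\<in>{0<..<1}. I t \<noteq> 0 \<longrightarrow>
        rearr_avg M f t - ennreal (rearr M f t)
          \<le> ennreal (t / I t) * rearr_avg M (grad_mod f) t)"

end

theory Submission
  imports Defs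
begin

text \<open>All four inequalities come from one localized coarea inequality: for Lipschitz \<open>f\<close> and \<open>a < b\<close>,
  the integral of \<open>I(\<lambda>\<^sub>f)\<close> over \<open>(a, b)\<close> is at most the integral of the gradient over
  \<open>{a < \<bar>f\<bar> \<le> b}\<close>. It follows from the definition of perimeter by comparing \<open>\<bar>f\<bar>\<close> with its supremum
  over small balls and using Fatou's lemma. With \<open>a = f\<^sup>*(s')\<close> and \<open>b = f\<^sup>*(s)\<close> it bounds increments
  of \<open>f\<^sup>*\<close> by those of \<open>\<Phi>(s)\<close>, the integral of the gradient over \<open>{\<bar>f\<bar> > f\<^sup>*(s)}\<close>; since monotone
  functions are differentiable almost everywhere, this gives (ii). For (iii) the same bound is applied
  to the excess of the gradient over a level \<open>c\<close>, and it suffices to compare the integrals of the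
  excesses. For (iv), concavity makes \<open>I(r)/r\<close> decreasing, so the coarea inequality controls the
  integral of \<open>\<lambda>\<^sub>f\<close> above the level \<open>f\<^sup>*(t)\<close>.\<close>

subsection \<open>Differentiability of monotone functions\<close>

text \<open>All four statements are proved outright, so their equivalence is immediate. What shapes
  the argument is that, as functions of s, the rearrangement and the superlevel integrals are only
  known to be monotone: they may have jumps, flat stretches and singular parts. The chain rule and
  the fundamental theorem of calculus are therefore replaced by two facts about monotone functions:
  a derivative exists almost everywhere, and its integral is at most the total increase. Statement
  (iii) uses the second fact in exactly this direction. Passing to excesses turns (iii) into a
  comparison of integrals over all of (0,1) and over the whole space, so no set realising the
  rearrangement on the left has to be chosen. The price is that the increment of c s must absorb c
  times the measure of the set where |f| lies between \<open>rearr M f s'\<close> and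
  \<open>rearr M f s\<close>. That measure is at most s' - s when the distribution function takes
  the value s at the level \<open>rearr M f s\<close>. This can fail where the distribution function
  jumps, but there a derivative of the rearrangement, if it exists, is 0.\<close>

lemma Vitali_covering_intervals:
  fixes K :: "(real \<times> real) set"
  assumes K: "\<And>i. i \<in> K \<Longrightarrow> fst i < snd i"
    and S: "\<And>x d. x \<in> S \<Longrightarrow> 0 < d \<Longrightarrow> \<exists>i\<in>K. x \<in> {fst i..snd i} \<and> snd i - fst i < d"
  obtains C where "countable C" "C \<subseteq> K" "pairwise (\<lambda>i j. disjnt {fst i..snd i} {fst j..snd j}) C"
    "negligible (S - (\<Union>i\<in>C. {fst i..snd i}))"
proof -
  \<comment> \<open>A closed interval is the closed ball about its midpoint, and the covering
    theorem for balls lets the covered point lie anywhere in the ball.\<close>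
  define m where "m = (\<lambda>i::real \<times> real. (fst i + snd i) / 2)"
  define r where "r = (\<lambda>i::real \<times> real. (snd i - fst i) / 2)"
  have cball: "cball (m i) (r i) = {fst i..snd i}" for i
    by (auto simp: m_def r_def cball_eq_atLeastAtMost field_simps)
  have "\<exists>i. i \<in> K \<and> x \<in> cball (m i) (r i) \<and> r i < d" if "x \<in> S" "0 < d" for x d
  proof -
    have "0 < 2 * d" using that by simp
    from S[OF that(1) this] obtain i where "i \<in> K" "x \<in> {fst i..snd i}" "snd i - fst i < 2 * d"
      by blast
    then show ?thesis unfolding cball by (intro exI[of _ i]) (simp add: r_def)
  qed
  note covering = this
  have "0 < r i" if "i \<in> K" for i using K[OF that] by (simp add: r_def)
  from Vitali_covering_theorem_cballs[where a = m and r = r, OF this covering]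
  obtain C where "countable C" "C \<subseteq> K"
     "pairwise (\<lambda>i j. disjnt (cball (m i) (r i)) (cball (m j) (r j))) C"
     "negligible (S - (\<Union>i \<in> C. cball (m i) (r i)))" .
  then show ?thesis using that unfolding cball by blast
qed

text \<open>Induction with the right end \<open>B\<close> left free: the interval with the largest
  left endpoint is split off, and by disjointness all others end before it, so its left endpoint
  replaces \<open>B\<close> for them.\<close>

lemma sum_increments_le:
  fixes f :: "real \<Rightarrow> real"
  assumes "mono f" "finite C" "A \<le> B"
    and "\<And>i. i \<in> C \<Longrightarrow> A \<le> fst i \<and> fst i \<le> snd i \<and> snd i \<le> B"
    and "pairwise (\<lambda>i j. disjnt {fst i..snd i} {fst j..snd j}) C"
  shows "(\<Sum>i\<in>C. f (snd i) - f (fst i)) \<le> f B - f A"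
  using assms(2-)
proof (induction "card C" arbitrary: C B)
  case 0
  then show ?case using monoD[OF \<open>mono f\<close>, of A B] by simp
next
  case (Suc n)
  then have ne: "C \<noteq> {}" by auto
  obtain k where k: "k \<in> C" "\<And>i. i \<in> C \<Longrightarrow> fst i \<le> fst k"
    using Max_in[of "fst ` C"] Max_ge[of "fst ` C"] ne Suc.prems(1) by fastforce
  have left: "snd i < fst k" if "i \<in> C - {k}" for i
  proof (rule ccontr)
    assume "\<not> snd i < fst k"
    then have "fst k \<in> {fst i..snd i} \<inter> {fst k..snd k}"
      using k(2)[of i] Suc.prems(3)[of k] k(1) that by auto
    moreover have "disjnt {fst i..snd i} {fst k..snd k}"
      using Suc.prems(4) that k(1) unfolding pairwise_def by blast
    ultimately show False unfolding disjnt_def by blast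
  qed
  have "(\<Sum>i\<in>C - {k}. f (snd i) - f (fst i)) \<le> f (fst k) - f A"
  proof (rule Suc.hyps(1))
    show "n = card (C - {k})" using Suc.hyps(2) k(1) Suc.prems(1) by simp
    show "pairwise (\<lambda>i j. disjnt {fst i..snd i} {fst j..snd j}) (C - {k})"
      using Suc.prems(4) by (rule pairwise_subset) auto
  qed (use Suc.prems k left in \<open>auto intro: less_imp_le\<close>)
  moreover have "f (snd k) \<le> f B" using Suc.prems(3)[OF k(1)] monoD[OF \<open>mono f\<close>] by auto
  moreover have "(\<Sum>i\<in>C. f (snd i) - f (fst i))
      = (f (snd k) - f (fst k)) + (\<Sum>i\<in>C - {k}. f (snd i) - f (fst i))"
    using Suc.prems(1) k(1) by (rule sum.remove)
  ultimately show ?case by simp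
qed

lemma measure_disjoint_intervals:
  fixes C :: "(real \<times> real) set"
  assumes "finite C" "\<And>i. i \<in> C \<Longrightarrow> fst i \<le> snd i"
    and "pairwise (\<lambda>i j. disjnt {fst i..snd i} {fst j..snd j}) C"
  shows "measure lebesgue (\<Union>i\<in>C. {fst i..snd i}) = (\<Sum>i\<in>C. snd i - fst i)"
proof -
  have "measure lebesgue (\<Union>i\<in>C. {fst i..snd i}) = (\<Sum>i\<in>C. measure lebesgue {fst i..snd i})"
    using assms(1,3) by (intro measure_UNION') auto
  also have "\<dots> = (\<Sum>i\<in>C. snd i - fst i)"
    using assms(2) by (intro sum.cong) auto
  finally show ?thesis .
qed

text \<open>A Markov-type estimate: disjoint intervals of slope at least \<open>q\<close> have total
  length at most their total increment over \<open>q\<close>. The bound \<open>B\<close> is a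
  hypothesis because it is the full increase of the function in one application and an increase
  already limited by flat intervals in the other.\<close>

lemma steep_intervals_cover:
  fixes f :: "real \<Rightarrow> real"
  assumes "0 < q"
    and K: "\<And>i. i \<in> K \<Longrightarrow> fst i < snd i \<and> q * (snd i - fst i) \<le> f (snd i) - f (fst i)"
    and S: "\<And>x d. x \<in> S \<Longrightarrow> 0 < d \<Longrightarrow> \<exists>i\<in>K. x \<in> {fst i..snd i} \<and> snd i - fst i < d"
    and B: "\<And>C. finite C \<Longrightarrow> C \<subseteq> K \<Longrightarrow> pairwise (\<lambda>i j. disjnt {fst i..snd i} {fst j..snd j}) C
              \<Longrightarrow> (\<Sum>i\<in>C. f (snd i) - f (fst i)) \<le> B"
  obtains T where "S \<subseteq> T" "T \<in> lmeasurable" "measure lebesgue T \<le> B / q"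
proof -
  obtain C where C: "countable C" "C \<subseteq> K" "pairwise (\<lambda>i j. disjnt {fst i..snd i} {fst j..snd j}) C"
    and neg: "negligible (S - (\<Union>i\<in>C. {fst i..snd i}))"
    using Vitali_covering_intervals[of K S] K S by blast
  have fin: "measure lebesgue (\<Union>i\<in>D. {fst i..snd i}) \<le> B / q" if D: "D \<subseteq> C" "finite D" for D
  proof -
    have pw: "pairwise (\<lambda>i j. disjnt {fst i..snd i} {fst j..snd j}) D"
      using C(3) D(1) by (rule pairwise_subset)
    have "q * (\<Sum>i\<in>D. snd i - fst i) \<le> (\<Sum>i\<in>D. f (snd i) - f (fst i))"
      unfolding sum_distrib_left using K D C by (intro sum_mono) blast
    also have "\<dots> \<le> B" using B[OF D(2) _ pw] D(1) C(2) by auto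
    finally have "(\<Sum>i\<in>D. snd i - fst i) \<le> B / q"
      using \<open>0 < q\<close> by (simp add: field_simps)
    moreover have "fst i \<le> snd i" if "i \<in> D" for i using K[of i] C(2) D(1) that by force
    ultimately show ?thesis
      using measure_disjoint_intervals[OF D(2) _ pw] by simp
  qed
  have m: "{fst i..snd i} \<in> lmeasurable" for i :: "real \<times> real" by simp
  define U where "U = (\<Union>i\<in>C. {fst i..snd i})"
  have U: "U \<in> lmeasurable" "measure lebesgue U \<le> B / q"
    unfolding U_def using fmeasurable_UN_bound[OF C(1) m fin] measure_UN_bound[OF C(1) m fin] by auto
  show ?thesis
  proof
    show "S \<subseteq> U \<union> (S - U)" by auto
    show "U \<union> (S - U) \<in> lmeasurable"
      using U neg by (metis U_def fmeasurable.Un negligible_imp_measurable)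
    show "measure lebesgue (U \<union> (S - U)) \<le> B / q"
      using U neg measure_Un_le[of U lebesgue "S - U"] negligible_imp_measure0[OF neg]
      by (simp add: U_def fmeasurableD negligible_imp_sets)
  qed
qed

text \<open>The intervals need not be centred at the point, so that one-sided difference quotients are
  covered as well.\<close>

definition steep_points :: "(real \<Rightarrow> real) \<Rightarrow> real \<Rightarrow> real set" where
  "steep_points f q = {x. \<forall>d>0. \<exists>a b. a < b \<and> x \<in> {a..b} \<and> b - a < d \<and> q * (b - a) < f b - f a}"

definition flat_points :: "(real \<Rightarrow> real) \<Rightarrow> real \<Rightarrow> real set" where
  "flat_points f p = {x. \<forall>d>0. \<exists>a b. a < b \<and> x \<in> {a..b} \<and> b - a < d \<and> f b - f a < p * (b - a)}"

text \<open>In a bounded window the total increase is fixed, so covers by intervals of slope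
  \<open>q\<close> have measure of order 1 / q, and \<open>q\<close> is arbitrary.\<close>

lemma negligible_infinitely_steep:
  assumes "mono f"
  shows "negligible (\<Inter>q. steep_points f q)"
proof -
  have "negligible ((\<Inter>q. steep_points f q) \<inter> {- real n<..<real n})" (is "negligible ?E") for n
    unfolding negligible_outer_le
  proof (intro allI impI)
    fix e :: real assume "0 < e"
    \<comment> \<open>The summand 1 keeps \<open>D\<close>, and with it the slope
      \<open>D / e\<close>, positive even if the function is constant on the window.\<close>
    define D where "D = f (real n) - f (- real n) + 1"
    have D: "0 < D" using monoD[OF \<open>mono f\<close>, of "- real n" "real n"] by (simp add: D_def)
    define q where "q = D / e"
    have q: "0 < q" using D \<open>0 < e\<close> by (simp add: q_def)
    define K where "K = {i. fst i < snd i \<and> q * (snd i - fst i) \<le> f (snd i) - f (fst i)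
      \<and> - real n \<le> fst i \<and> snd i \<le> real n}"
    obtain T where "?E \<subseteq> T" "T \<in> lmeasurable" "measure lebesgue T \<le> D / q"
    proof (rule steep_intervals_cover[of q K f ?E D])
      fix x d :: real assume x: "x \<in> ?E" and "0 < d"
      define d' where "d' = Min {d, x + real n, real n - x}"
      have "0 < d'" using x \<open>0 < d\<close> by (simp add: d'_def)
      then obtain a b where ab: "a < b" "x \<in> {a..b}" "b - a < d'" "q * (b - a) < f b - f a"
        using x unfolding steep_points_def by blast
      then have "(a, b) \<in> K" "x \<in> {a..b}" "b - a < d" by (auto simp: K_def d'_def)
      then show "\<exists>i\<in>K. x \<in> {fst i..snd i} \<and> snd i - fst i < d" by (intro bexI[of _ "(a, b)"]) auto
    next
      fix C assume C: "finite C" "C \<subseteq> K" "pairwise (\<lambda>i j. disjnt {fst i..snd i} {fst j..snd j}) C"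
      have "(\<Sum>i\<in>C. f (snd i) - f (fst i)) \<le> f (real n) - f (- real n)"
        by (rule sum_increments_le[OF \<open>mono f\<close> C(1) _ _ C(3)]) (use C(2) in \<open>force simp: K_def\<close>)+
      then show "(\<Sum>i\<in>C. f (snd i) - f (fst i)) \<le> D" by (simp add: D_def)
    qed (use q in \<open>auto simp: K_def\<close>)
    moreover have "D / q = e" using D \<open>0 < e\<close> by (simp add: q_def)
    ultimately show "\<exists>T. ?E \<subseteq> T \<and> T \<in> lmeasurable \<and> measure lebesgue T \<le> e" by auto
  qed
  then have "negligible (\<Union>n. (\<Inter>q. steep_points f q) \<inter> {- real n<..<real n})"
    by (intro negligible_countable_Union) auto
  moreover have "(\<Inter>q. steep_points f q) \<subseteq> (\<Union>n. (\<Inter>q. steep_points f q) \<inter> {- real n<..<real n})"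
  proof
    fix x assume "x \<in> (\<Inter>q. steep_points f q)"
    moreover obtain n where "\<bar>x\<bar> < real n" using reals_Archimedean2 by blast
    ultimately show "x \<in> (\<Union>n. (\<Inter>q. steep_points f q) \<inter> {- real n<..<real n})"
      by (intro UN_I[of n]) auto
  qed
  ultimately show ?thesis using negligible_subset by blast
qed

text \<open>One application of Vitali's theorem to flat intervals inside a neighbourhood of \<open>E\<close>, followed by
  one to steep intervals inside these, shrinks the measure of a cover of \<open>E\<close> by the factor \<open>p / q\<close>.\<close>

lemma flat_steep_cover_shrinks:
  assumes "mono f" "0 < p" "p < q" and E: "E \<subseteq> flat_points f p \<inter> steep_points f q"
    and T: "E \<subseteq> T" "T \<in> lmeasurable" and "0 < e"
  obtains T' where "E \<subseteq> T'" "T' \<in> lmeasurable" "measure lebesgue T' \<le> p / q * (measure lebesgue T + e)"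
proof -
  obtain U where U': "open U" "T \<subseteq> U" "U - T \<in> lmeasurable" "emeasure lebesgue (U - T) < ennreal e"
    using sets_lebesgue_outer_open[OF fmeasurableD[OF T(2)] \<open>0 < e\<close>] by blast
  have "U = T \<union> (U - T)" using U'(2) by auto
  then have "U \<in> lmeasurable" using U'(3) T(2) by (metis fmeasurable.Un)
  moreover have "measure lebesgue (U - T) < e"
    using U'(4) \<open>0 < e\<close> by (simp add: emeasure_eq_measure2[OF U'(3)] ennreal_less_iff)
  ultimately have U: "open U" "T \<subseteq> U" "U \<in> lmeasurable" "measure lebesgue (U - T) < e"
    using U' by auto
  have mU: "measure lebesgue U \<le> measure lebesgue T + e"
    using measurable_measure_Diff[OF U(3) fmeasurableD[OF T(2)] U(2)] U(4) by simp
  \<comment> \<open>Flat intervals are kept inside the open set \<open>U\<close>, so disjoint ones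
    have total length at most \<open>measure lebesgue U\<close>, and the function rises on them by
    at most \<open>p\<close> times that.\<close>
  define K where "K = {i. fst i < snd i \<and> f (snd i) - f (fst i) < p * (snd i - fst i)
    \<and> {fst i..snd i} \<subseteq> U}"
  obtain C where C: "countable C" "C \<subseteq> K" "pairwise (\<lambda>i j. disjnt {fst i..snd i} {fst j..snd j}) C"
    and neg: "negligible (E - (\<Union>i\<in>C. {fst i..snd i}))"
  proof (rule Vitali_covering_intervals[of K E])
    fix x d :: real assume x: "x \<in> E" "0 < d"
    obtain r where r: "0 < r" "ball x r \<subseteq> U"
      using U(1,2) T(1) x(1) open_contains_ball by blast
    have "x \<in> flat_points f p" "0 < min d r" using E x r(1) by auto
    then obtain a b where ab: "a < b" "x \<in> {a..b}" "b - a < min d r" "f b - f a < p * (b - a)"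
      unfolding flat_points_def by blast
    then have "{a..b} \<subseteq> ball x r" by (auto simp: dist_real_def)
    then have "(a, b) \<in> K" using ab r(2) unfolding K_def by auto
    then show "\<exists>i\<in>K. x \<in> {fst i..snd i} \<and> snd i - fst i < d"
      using ab by (intro bexI[of _ "(a, b)"]) auto
  qed (auto simp: K_def)
  \<comment> \<open>Steep intervals must lie in the interior of a selected flat one; the points lost
    in this way are endpoints of countably many intervals.\<close>
  define L where "L = {j. fst j < snd j \<and> q * (snd j - fst j) \<le> f (snd j) - f (fst j)
    \<and> (\<exists>i\<in>C. {fst j..snd j} \<subseteq> {fst i<..<snd i})}"
  have fin: "(\<Sum>j\<in>D. f (snd j) - f (fst j)) \<le> p * measure lebesgue U"
    if D: "finite D" "D \<subseteq> L" "pairwise (\<lambda>i j. disjnt {fst i..snd i} {fst j..snd j}) D" for D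
  proof -
    have "\<forall>j\<in>D. \<exists>i\<in>C. {fst j..snd j} \<subseteq> {fst i<..<snd i}" using D(2) by (auto simp: L_def)
    then obtain g where g: "\<And>j. j \<in> D \<Longrightarrow> g j \<in> C \<and> {fst j..snd j} \<subseteq> {fst (g j)<..<snd (g j)}"
      by metis
    have sub: "g ` D \<subseteq> C" using g by auto
    have pw: "pairwise (\<lambda>i j. disjnt {fst i..snd i} {fst j..snd j}) (g ` D)"
      using C(3) sub by (rule pairwise_subset)
    have le: "fst i \<le> snd i" if "i \<in> g ` D" for i
      using that sub C(2) by (auto simp: K_def dest!: subsetD)
    have lt: "fst j < snd j" if "j \<in> D" for j using that D(2) by (auto simp: L_def)
    \<comment> \<open>Grouping the steep intervals by the flat interval that contains them: the
      rises within one group cannot exceed the rise over that flat interval.\<close>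
    have "(\<Sum>j\<in>D. f (snd j) - f (fst j)) = (\<Sum>i\<in>g ` D. \<Sum>j | j \<in> D \<and> g j = i. f (snd j) - f (fst j))"
      using D(1) by (rule sum.image_gen)
    also have "\<dots> \<le> (\<Sum>i\<in>g ` D. p * (snd i - fst i))"
    proof (rule sum_mono)
      fix i assume i: "i \<in> g ` D"
      then have iK: "i \<in> K" using sub C(2) by auto
      have "(\<Sum>j | j \<in> D \<and> g j = i. f (snd j) - f (fst j)) \<le> f (snd i) - f (fst i)"
      proof (rule sum_increments_le[OF \<open>mono f\<close>])
        fix j assume j: "j \<in> {j \<in> D. g j = i}"
        then have "{fst j..snd j} \<subseteq> {fst i<..<snd i}" "fst j < snd j" using g[of j] lt[of j] by auto
        then have "fst j \<in> {fst i<..<snd i}" "snd j \<in> {fst i<..<snd i}"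
          by (meson atLeastAtMost_iff less_imp_le order_refl subsetD)+
        then show "fst i \<le> fst j \<and> fst j \<le> snd j \<and> snd j \<le> snd i" using lt[of j] j by auto
      qed (use D iK in \<open>auto simp: K_def intro: pairwise_subset\<close>)
      also have "\<dots> \<le> p * (snd i - fst i)" using iK by (simp add: K_def)
      finally show "(\<Sum>j | j \<in> D \<and> g j = i. f (snd j) - f (fst j)) \<le> p * (snd i - fst i)" .
    qed
    also have "\<dots> = p * measure lebesgue (\<Union>i\<in>g ` D. {fst i..snd i})"
      unfolding sum_distrib_left[symmetric]
      using le D(1) by (subst measure_disjoint_intervals[OF _ _ pw]) auto
    also have "\<dots> \<le> p * measure lebesgue U"
    proof (rule mult_left_mono[OF measure_mono_fmeasurable])
      show "(\<Union>i\<in>g ` D. {fst i..snd i}) \<subseteq> U" using sub C(2) unfolding K_def by blast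
      show "(\<Union>i\<in>g ` D. {fst i..snd i}) \<in> sets lebesgue" using D(1) by (intro sets.finite_UN) auto
    qed (use U \<open>0 < p\<close> in auto)
    finally show ?thesis .
  qed
  define S where "S = E \<inter> (\<Union>i\<in>C. {fst i<..<snd i})"
  obtain V where V: "S \<subseteq> V" "V \<in> lmeasurable" "measure lebesgue V \<le> p * measure lebesgue U / q"
  proof (rule steep_intervals_cover[of q L f S])
    fix x d :: real assume x: "x \<in> S" "0 < d"
    then obtain i where i: "i \<in> C" "x \<in> {fst i<..<snd i}" by (auto simp: S_def)
    define d' where "d' = Min {d, x - fst i, snd i - x}"
    have "0 < d'" using x i by (simp add: d'_def)
    moreover have "x \<in> steep_points f q" using x E by (auto simp: S_def)
    ultimately obtain a b where ab: "a < b" "x \<in> {a..b}" "b - a < d'" "q * (b - a) < f b - f a"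
      unfolding steep_points_def by blast
    then have "{a..b} \<subseteq> {fst i<..<snd i}" by (auto simp: d'_def)
    then have "(a, b) \<in> L" using ab i by (auto simp: L_def)
    then show "\<exists>i\<in>L. x \<in> {fst i..snd i} \<and> snd i - fst i < d"
      using ab by (intro bexI[of _ "(a, b)"]) (auto simp: d'_def)
  qed (use fin assms in \<open>auto simp: L_def\<close>)
  define N where "N = E - S"
  have "N \<subseteq> (E - (\<Union>i\<in>C. {fst i..snd i})) \<union> (fst ` C \<union> snd ` C)"
    unfolding N_def S_def by force
  moreover have "negligible (fst ` C \<union> snd ` C)"
    using C(1) countable_imp_null_set_lborel[of "fst ` C \<union> snd ` C"]
    by (auto simp: negligible_iff_null_sets intro: null_sets_completionI)
  ultimately have N: "negligible N"
    using neg by (meson negligible_Un negligible_subset)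
  show ?thesis
  proof
    show "E \<subseteq> V \<union> N" using V(1) by (auto simp: N_def)
    show "V \<union> N \<in> lmeasurable" using V(2) N by (simp add: fmeasurable.Un negligible_imp_measurable)
    have "measure lebesgue (V \<union> N) \<le> measure lebesgue V"
      using V N measure_Un_le[of V lebesgue N] negligible_imp_measure0[OF N]
      by (simp add: fmeasurableD negligible_imp_sets)
    also have "\<dots> \<le> p / q * measure lebesgue U" using V(3) by simp
    also have "\<dots> \<le> p / q * (measure lebesgue T + e)"
      using mU assms by (intro mult_left_mono) auto
    finally show "measure lebesgue (V \<union> N) \<le> p / q * (measure lebesgue T + e)" .
  qed
qed

lemma flat_points_nonpos:
  assumes "mono f" "p \<le> 0"
  shows "flat_points f p = {}"
proof -
  have "\<not> f b - f a < p * (b - a)" if "a < b" for a b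
    using monoD[OF assms(1), of a b] that mult_nonpos_nonneg[OF assms(2), of "b - a"] by simp
  then show ?thesis unfolding flat_points_def using zero_less_one by blast
qed

text \<open>Let \<open>m\<close> be the outer measure of a bounded piece. Shrinking covers, with the
  slack tending to 0, gives m \<le> (p / q) m, and p < q with \<open>m\<close> finite forces m = 0.
  For p \<le> 0 monotonicity excludes flat intervals altogether.\<close>

lemma negligible_flat_steep:
  assumes "mono f" "p < q"
  shows "negligible (flat_points f p \<inter> steep_points f q)"
proof (cases "0 < p")
  case False
  then show ?thesis using flat_points_nonpos[OF assms(1), of p] by simp
next
  case True
  have "negligible (flat_points f p \<inter> steep_points f q \<inter> {- real n..real n})" (is "negligible ?E") for n
  proof -
    define X where "X = measure lebesgue ` {T \<in> lmeasurable. ?E \<subseteq> T}"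
    have "?E \<subseteq> {- real n..real n}" "{- real n..real n} \<in> lmeasurable" by auto
    then have ne: "measure lebesgue {- real n..real n} \<in> X" unfolding X_def by (intro imageI CollectI conjI)
    have bdd: "bdd_below X" by (rule bdd_belowI[of _ 0]) (auto simp: X_def)
    define m where "m = Inf X"
    have m0: "0 \<le> m" unfolding m_def by (rule cInf_greatest) (use ne in \<open>auto simp: X_def\<close>)
    have "m \<le> p / q * (x + e)" if x: "x \<in> X" "0 < e" for x e
    proof -
      obtain T where T: "?E \<subseteq> T" "T \<in> lmeasurable" "x = measure lebesgue T"
        using x(1) unfolding X_def by blast
      have "?E \<subseteq> flat_points f p \<inter> steep_points f q" by blast
      from flat_steep_cover_shrinks[OF assms(1) True assms(2) this T(1,2) x(2)]
      obtain T' where "?E \<subseteq> T'" "T' \<in> lmeasurable" "measure lebesgue T' \<le> p / q * (x + e)"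
        unfolding T(3) by blast
      moreover from this have "m \<le> measure lebesgue T'"
        unfolding m_def using bdd by (intro cInf_lower) (auto simp only: X_def intro!: imageI)
      ultimately show ?thesis by simp
    qed
    note * = this
    have "m * q / p - e \<le> x" if "x \<in> X" "0 < e" for x e
    proof -
      have "m \<le> p * (x + e) / q" using *[OF that] by simp
      then have "m * q \<le> (x + e) * p" using True assms(2) by (simp add: pos_le_divide_eq mult.commute)
      then have "m * q / p \<le> x + e" using True by (simp add: pos_divide_le_eq)
      then show ?thesis by simp
    qed
    then have "m * q / p - e \<le> Inf X" if "0 < e" for e
      using that ne by (intro cInf_greatest) auto
    then have "m * q / p \<le> m + e" if "0 < e" for e using that unfolding m_def by (simp add: diff_le_eq)
    then have "m * q / p \<le> m" by (rule field_le_epsilon)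
    then have "m * q \<le> m * p" using True by (simp add: pos_divide_le_eq)
    then have "m * (q - p) \<le> 0" by (simp add: right_diff_distrib)
    then have "m = 0" using m0 assms(2) by (simp add: mult_le_0_iff)
    show ?thesis unfolding negligible_outer
    proof (intro allI impI)
      fix e :: real assume "0 < e"
      then have "Inf X < e" using \<open>m = 0\<close> m_def by simp
      then obtain x where "x \<in> X" "x < e" using ne cInf_lessD by (metis empty_iff)
      then show "\<exists>T. ?E \<subseteq> T \<and> T \<in> lmeasurable \<and> measure lebesgue T < e"
        unfolding X_def by blast
    qed
  qed
  then have "negligible (\<Union>n. flat_points f p \<inter> steep_points f q \<inter> {- real n..real n})"
    by (intro negligible_countable_Union) auto
  moreover have "flat_points f p \<inter> steep_points f q \<subseteq> (\<Union>n. flat_points f p \<inter> steep_points f q \<inter> {- real n..real n})"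
  proof
    fix x assume "x \<in> flat_points f p \<inter> steep_points f q"
    moreover obtain n where "\<bar>x\<bar> \<le> real n" using real_arch_simple by blast
    ultimately show "x \<in> (\<Union>n. flat_points f p \<inter> steep_points f q \<inter> {- real n..real n})"
      by (intro UN_I[of n]) auto
  qed
  ultimately show ?thesis using negligible_subset by blast
qed

text \<open>The derivative will be the infimum \<open>l\<close> of the slopes at which the point is
  not steep. If slopes below l - e occurred in arbitrarily short intervals around the point,
  rationals p < q in (l - e, l) would make it flat for \<open>p\<close> and steep for
  \<open>q\<close>.\<close>

lemma differentiable_off_flat_steep:
  fixes f :: "real \<Rightarrow> real"
  assumes "mono f" "x \<notin> (\<Inter>q. steep_points f q)"
    and "\<And>p q. p \<in> \<rat> \<Longrightarrow> q \<in> \<rat> \<Longrightarrow> p < q \<Longrightarrow> x \<notin> flat_points f p \<inter> steep_points f q"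
  shows "f differentiable (at x)"
proof -
  define X where "X = {q. x \<notin> steep_points f q}"
  have up: "q' \<in> X" if "q \<in> X" "q \<le> q'" for q q'
  proof -
    have "q * (b - a) < f b - f a" if "q' * (b - a) < f b - f a" "a < b" for a b
      using that mult_right_mono[OF \<open>q \<le> q'\<close>, of "b - a"] by linarith
    with that(1) show ?thesis unfolding X_def steep_points_def by blast
  qed
  \<comment> \<open>A monotone function is steep for every negative slope, so the infimum is
    finite.\<close>
  have ge0: "0 \<le> q" if "q \<in> X" for q
  proof (rule ccontr)
    assume "\<not> 0 \<le> q"
    have "\<exists>a b. a < b \<and> x \<in> {a..b} \<and> b - a < d \<and> q * (b - a) < f b - f a" if "0 < d" for d
    proof (rule exI[of _ x], rule exI[of _ "x + d / 2"], intro conjI)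
      have "q * (d / 2) < 0" using \<open>\<not> 0 \<le> q\<close> \<open>0 < d\<close> by (simp add: mult_neg_pos)
      then show "q * (x + d / 2 - x) < f (x + d / 2) - f x"
        using monoD[OF assms(1), of x "x + d / 2"] \<open>0 < d\<close> by simp
    qed (use \<open>0 < d\<close> in auto)
    then show False using that by (auto simp: X_def steep_points_def)
  qed
  have ne: "X \<noteq> {}" using assms(2) by (auto simp: X_def)
  have bdd: "bdd_below X" using ge0 by (rule bdd_belowI)
  define l where "l = Inf X"
  have steepX: "l + e \<in> X" if "0 < e" for e
  proof -
    obtain q where "q \<in> X" "q < l + e" using cInf_lessD[OF ne, of "l + e"] \<open>0 < e\<close> l_def by auto
    then show ?thesis using up by auto
  qed
  have flat: "x \<notin> flat_points f (l - e)" if "0 < e" for e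
  proof
    assume *: "x \<in> flat_points f (l - e)"
    obtain p where p: "p \<in> \<rat>" "l - e < p" "p < l" using Rats_dense_in_real[of "l - e" l] \<open>0 < e\<close> by auto
    obtain q where q: "q \<in> \<rat>" "p < q" "q < l" using Rats_dense_in_real[of p l] p by auto
    have "q \<notin> X" using cInf_lower[OF _ bdd, of q] q(3) l_def by auto
    moreover have "f b - f a < p * (b - a)" if "f b - f a < (l - e) * (b - a)" "a < b" for a b
      using that mult_right_mono[of "l - e" p "b - a"] p(2) by linarith
    then have "x \<in> flat_points f p" using * unfolding flat_points_def by blast
    ultimately show False using assms(3)[OF p(1) q(1,2)] by (auto simp: X_def)
  qed
  have close: "\<exists>d>0. \<forall>a b. a < b \<and> x \<in> {a..b} \<and> b - a < d \<longrightarrow> \<bar>(f b - f a) / (b - a) - l\<bar> \<le> e"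
    if e: "0 < e" for e
  proof -
    obtain d1 where d1: "0 < d1" "\<And>a b. a < b \<Longrightarrow> x \<in> {a..b} \<Longrightarrow> b - a < d1 \<Longrightarrow> f b - f a \<le> (l + e) * (b - a)"
      using steepX[OF e] unfolding X_def steep_points_def by force
    obtain d2 where d2: "0 < d2" "\<And>a b. a < b \<Longrightarrow> x \<in> {a..b} \<Longrightarrow> b - a < d2 \<Longrightarrow> (l - e) * (b - a) \<le> f b - f a"
      using flat[OF e] unfolding flat_points_def by force
    have "\<bar>(f b - f a) / (b - a) - l\<bar> \<le> e" if "a < b" "x \<in> {a..b}" "b - a < min d1 d2" for a b
      using d1(2)[of a b] d2(2)[of a b] that by (auto simp: abs_le_iff field_simps)
    then show ?thesis using d1(1) d2(1) by (intro exI[of _ "min d1 d2"]) auto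
  qed
  have "((\<lambda>y. (f y - f x) / (y - x)) \<longlongrightarrow> l) (at x)"
    unfolding LIM_def
  proof (intro allI impI)
    fix e :: real assume "0 < e"
    then obtain d where d: "0 < d"
      "\<And>a b. a < b \<Longrightarrow> x \<in> {a..b} \<Longrightarrow> b - a < d \<Longrightarrow> \<bar>(f b - f a) / (b - a) - l\<bar> \<le> e / 2"
      using close[of "e / 2"] by auto
    have "dist ((f y - f x) / (y - x)) l < e" if "y \<noteq> x \<and> dist y x < d" for y
    proof (cases "x < y")
      case True
      then show ?thesis using d(2)[of x y] that \<open>0 < e\<close> by (auto simp: dist_real_def)
    next
      case False
      have "(f x - f y) / (x - y) = (f y - f x) / (y - x)" by (metis minus_diff_eq minus_divide_divide)
      then show ?thesis using d(2)[of y x] False that \<open>0 < e\<close> by (auto simp: dist_real_def)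
    qed
    then show "\<exists>d>0. \<forall>y. y \<noteq> x \<and> dist y x < d \<longrightarrow> dist ((f y - f x) / (y - x)) l < e"
      using d(1) by auto
  qed
  then have "(f has_real_derivative l) (at x)" by (simp add: has_field_derivative_iff)
  then show ?thesis using real_differentiable_def by blast
qed

theorem mono_differentiable_AE:
  fixes f :: "real \<Rightarrow> real"
  assumes "mono f"
  shows "AE x in lborel. f differentiable (at x)"
proof -
  define N where "N = (\<Inter>q. steep_points f q)
    \<union> (\<Union>(p, q)\<in>{(p, q). p \<in> \<rat> \<and> q \<in> \<rat> \<and> p < q}. flat_points f p \<inter> steep_points f q)"
  have "countable {(p::real, q). p \<in> \<rat> \<and> q \<in> \<rat> \<and> p < q}"
    by (rule countable_subset[of _ "\<rat> \<times> \<rat>"]) (auto simp: countable_rat)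
  then have "negligible N"
    unfolding N_def using negligible_infinitely_steep[OF assms] negligible_flat_steep[OF assms]
    by (intro negligible_Un negligible_countable_Union) auto
  then have "AE x in lebesgue. x \<notin> N" by (simp add: AE_not_in negligible_iff_null_sets)
  moreover have "f differentiable (at x)" if "x \<notin> N" for x
    using that by (intro differentiable_off_flat_steep[OF assms]) (auto simp: N_def)
  ultimately have "AE x in lebesgue. f differentiable (at x)" by (auto elim!: eventually_mono)
  then show ?thesis by (simp add: AE_completion_iff)
qed

text \<open>The function may be unbounded near the ends of the interval and then has no monotone
  extension to the line. Freezing it outside \<open>[c, d]\<close> for rational \<open>c\<close> and
  \<open>d\<close> gives countably many monotone functions on the line.\<close>

lemma mono_on_differentiable_AE:
  fixes f :: "real \<Rightarrow> real"
  assumes "mono_on {a<..<b} f"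
  shows "AE x in lborel. x \<in> {a<..<b} \<longrightarrow> f differentiable (at x)"
proof -
  define g where "g = (\<lambda>(c, d) x. f (max c (min d x)))"
  have "mono (g (c, d))" if "a < c" "c < d" "d < b" for c d
    unfolding g_def using that by (auto intro!: monoI mono_onD[OF assms])
  then have "AE x in lborel. g i differentiable (at x)"
    if "i \<in> {(c, d). c \<in> \<rat> \<and> d \<in> \<rat> \<and> a < c \<and> c < d \<and> d < b}" for i
    using that mono_differentiable_AE by force
  moreover have "countable {(c, d). c \<in> \<rat> \<and> d \<in> \<rat> \<and> a < c \<and> c < d \<and> d < b}"
    by (rule countable_subset[of _ "\<rat> \<times> \<rat>"]) (auto simp: countable_rat)
  ultimately have "AE x in lborel. \<forall>i\<in>{(c, d). c \<in> \<rat> \<and> d \<in> \<rat> \<and> a < c \<and> c < d \<and> d < b}. g i differentiable (at x)"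
    by (rule AE_ball_countable')
  then show ?thesis
  proof eventually_elim
    case (elim x)
    show ?case
    proof
      assume x: "x \<in> {a<..<b}"
      obtain c d where cd: "c \<in> \<rat>" "d \<in> \<rat>" "a < c" "c < x" "x < d" "d < b"
        using Rats_dense_in_real[of a x] Rats_dense_in_real[of x b] x by auto
      then have "g (c, d) differentiable (at x)" using elim by auto
      then obtain D where D: "(g (c, d) has_real_derivative D) (at x)"
        using real_differentiable_def by blast
      have "(f has_real_derivative D) (at x)"
        using D by (rule has_field_derivative_transform_within_open[of _ _ _ "{c<..<d}"])
          (use cd in \<open>auto simp: g_def\<close>)
      then show "f differentiable (at x)" using real_differentiable_def by blast
    qed
  qed
qed

section \<open>Derivatives as limits of difference quotients: measurability and integrals\<close>

lemma deriv_quotient_tendsto: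
  fixes F :: "real \<Rightarrow> real"
  assumes "F differentiable (at x)"
  shows "(\<lambda>n. real (Suc n) * (F (x + 1 / Suc n) - F x)) \<longlonglongrightarrow> deriv F x"
proof -
  have "(F has_real_derivative deriv F x) (at x)"
    using assms DERIV_deriv_iff_real_differentiable by blast
  then have "((\<lambda>h. (F (x + h) - F x) / h) \<longlongrightarrow> deriv F x) (at 0)" by (simp add: DERIV_def)
  moreover have "filterlim (\<lambda>n. 1 / real (Suc n)) (at 0) sequentially"
    using LIMSEQ_inverse_real_of_nat by (simp add: filterlim_at inverse_eq_divide)
  ultimately have "(\<lambda>n. (F (x + 1 / real (Suc n)) - F x) / (1 / real (Suc n))) \<longlonglongrightarrow> deriv F x"
    by (rule filterlim_compose)
  then show ?thesis by (simp add: mult.commute)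
qed

lemma eventually_shift_in_interval:
  assumes "x \<in> {a<..<b::real}"
  shows "eventually (\<lambda>n. x + 1 / real (Suc n) \<in> {a<..<b}) sequentially"
proof -
  have "(\<lambda>n. x + 1 / real (Suc n)) \<longlonglongrightarrow> x + 0"
    using LIMSEQ_inverse_real_of_nat by (intro tendsto_intros) (simp add: inverse_eq_divide)
  then show ?thesis using assms by (intro topological_tendstoD) auto
qed

text \<open>The difference quotients along 1 / (n + 1) have a Borel limit function that equals
  \<open>deriv F\<close> almost everywhere. On the exceptional null set \<open>deriv\<close> is
  uncontrolled, so the conclusion is Lebesgue and not Borel measurability.\<close>

lemma deriv_measurable_lebesgue_on:
  fixes F :: "real \<Rightarrow> real"
  assumes F: "F \<in> borel_measurable (restrict_space borel {a<..<b})"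
    and diff: "AE x in lborel. x \<in> {a<..<b} \<longrightarrow> F differentiable (at x)"
  shows "deriv F \<in> borel_measurable (lebesgue_on {a<..<b})"
proof -
  define G where "G = (\<lambda>x. indicator {a<..<b} x *\<^sub>R F x)"
  have G[measurable]: "G \<in> borel_measurable borel"
    using F unfolding G_def
    by (simp add: borel_measurable_restrict_space_iff)
  define D where "D = (\<lambda>x. lim (\<lambda>n. real (Suc n) * (G (x + 1 / Suc n) - G x)))"
  have "D \<in> borel_measurable borel" unfolding D_def by measurable
  then have D: "D \<in> borel_measurable lebesgue" by (simp add: measurable_completion)
  have "AE x in lebesgue. indicator {a<..<b} x *\<^sub>R D x = indicator {a<..<b} x *\<^sub>R deriv F x"
    unfolding AE_completion_iff using diff
  proof eventually_elim
    case (elim x)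
    have "D x = deriv F x" if x: "x \<in> {a<..<b}"
    proof -
      have "eventually (\<lambda>n. x + 1 / real (Suc n) \<in> {a<..<b}) sequentially"
        using x by (rule eventually_shift_in_interval)
      then have "eventually (\<lambda>n. real (Suc n) * (F (x + 1 / Suc n) - F x)
          = real (Suc n) * (G (x + 1 / Suc n) - G x)) sequentially"
        by (rule eventually_mono) (use x in \<open>simp add: G_def del: of_nat_Suc\<close>)
      moreover have "(\<lambda>n. real (Suc n) * (F (x + 1 / Suc n) - F x)) \<longlonglongrightarrow> deriv F x"
        using deriv_quotient_tendsto elim x by blast
      ultimately have "(\<lambda>n. real (Suc n) * (G (x + 1 / Suc n) - G x)) \<longlonglongrightarrow> deriv F x"
        by (rule Lim_transform_eventually[rotated])
      then show ?thesis unfolding D_def by (rule limI)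
    qed
    then show ?case by (auto simp: indicator_def)
  qed
  moreover have "(\<lambda>x. indicator {a<..<b} x *\<^sub>R D x) \<in> borel_measurable lebesgue"
    by (intro borel_measurable_scaleR D borel_measurable_indicator) auto
  ultimately have "(\<lambda>x. indicator {a<..<b} x *\<^sub>R deriv F x) \<in> borel_measurable lebesgue"
    by (rule borel_measurable_AE[rotated])
  then show ?thesis by (simp add: borel_measurable_restrict_space_iff)
qed

text \<open>Fatou's lemma for the difference quotients, whose integrals telescope to at most
  \<open>B\<close>. Equality fails in general, as jumps and singular parts contribute to the
  increase but not to the derivative.\<close>

lemma nn_integral_deriv_mono_on_le:
  fixes \<Psi> :: "real \<Rightarrow> real"
  assumes "a < b" "mono_on {a<..<b} \<Psi>" and bd: "\<And>x. x \<in> {a<..<b} \<Longrightarrow> 0 \<le> \<Psi> x \<and> \<Psi> x \<le> B"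
    and diff: "AE x in lborel. x \<in> {a<..<b} \<longrightarrow> \<Psi> differentiable (at x)"
  shows "(\<integral>\<^sup>+x\<in>{a<..<b}. ennreal (deriv \<Psi> x) \<partial>lborel) \<le> ennreal B"
proof -
  have "0 \<le> B" using bd[of "(a + b) / 2"] \<open>a < b\<close> by auto
  \<comment> \<open>Continuing by the extreme values 0 and \<open>B\<close> keeps the function
    monotone, so that its quotients make sense when x + h leaves the interval.\<close>
  define E where "E = (\<lambda>x. if x \<le> a then 0 else if b \<le> x then B else \<Psi> x)"
  have E: "mono E"
    unfolding E_def using bd \<open>0 \<le> B\<close> by (intro monoI) (auto intro: mono_onD[OF assms(2)])
  have [measurable]: "E \<in> borel_measurable borel" using E by (rule borel_measurable_mono)
  have E0: "0 \<le> E x" "E x \<le> B" for x using bd \<open>0 \<le> B\<close> by (auto simp: E_def)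
  define Q where "Q = (\<lambda>n x. ennreal (real (Suc n) * (E (x + 1 / Suc n) - E x)) * indicator {a<..<b} x)"
  have Q: "(\<integral>\<^sup>+x. Q n x \<partial>lborel) \<le> ennreal B" for n
  proof -
    define h where "h = 1 / real (Suc n)"
    have h: "0 < h" by (simp add: h_def)
    let ?J = "\<integral>\<^sup>+x\<in>{a<..<b}. ennreal (E x) \<partial>lborel"
    let ?d = "\<integral>\<^sup>+x\<in>{a<..<b}. ennreal (E (x + h) - E x) \<partial>lborel"
    have "?J \<le> (\<integral>\<^sup>+x\<in>{a<..<b}. ennreal B \<partial>lborel)"
      using E0 by (intro nn_integral_mono mult_right_mono ennreal_leI) auto
    also have "\<dots> < \<infinity>" using \<open>a < b\<close> by (simp add: nn_integral_cmult ennreal_mult_less_top)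
    finally have J: "?J < \<infinity>" .
    \<comment> \<open>Translation by \<open>h\<close> changes the integral by at most
      \<open>B\<close> times \<open>h\<close>, the contribution of the strip beyond
      \<open>b\<close>. The sum avoids subtraction in \<open>ennreal\<close>; finiteness of
      \<open>?J\<close> allows cancelling afterwards.\<close>
    have "?d + ?J = (\<integral>\<^sup>+x\<in>{a<..<b}. ennreal (E (x + h)) \<partial>lborel)"
      using E0 monoD[OF E, of _ "_ + h"] h
      by (subst nn_integral_add[symmetric])
        (auto simp: indicator_def ennreal_plus[symmetric] simp del: ennreal_plus intro!: nn_integral_cong)
    also have "\<dots> = (\<integral>\<^sup>+x\<in>{a + h<..<b + h}. ennreal (E x) \<partial>lborel)"
      by (subst (2) nn_integral_real_affine[where c = 1 and t = h])
        (auto simp: indicator_def add.commute intro!: nn_integral_cong)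
    also have "\<dots> \<le> (\<integral>\<^sup>+x. ennreal (E x) * indicator {a<..<b} x + ennreal B * indicator {b..<b + h} x \<partial>lborel)"
      using h E0 by (intro nn_integral_mono) (auto simp: indicator_def intro: ennreal_leI)
    also have "\<dots> = ?J + ennreal B * ennreal h"
      using h by (subst nn_integral_add) (auto simp: nn_integral_cmult)
    finally have "?d \<le> ennreal B * ennreal h"
      using J by (simp add: add.commute[of ?d] ennreal_add_left_cancel_le less_top[symmetric])
    then have "ennreal (real (Suc n)) * ?d \<le> ennreal (real (Suc n)) * (ennreal B * ennreal h)"
      by (intro mult_left_mono) auto
    also have "\<dots> = ennreal B"
      using \<open>0 \<le> B\<close> h by (simp add: ennreal_mult[symmetric] h_def del: of_nat_Suc)
    also have "ennreal (real (Suc n)) * ?d = (\<integral>\<^sup>+x. Q n x \<partial>lborel)"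
      unfolding Q_def h_def using E0
      by (subst nn_integral_cmult[symmetric]) (auto simp: ennreal_mult' mult.assoc simp del: of_nat_Suc)
    finally show ?thesis .
  qed
  have "(\<integral>\<^sup>+x\<in>{a<..<b}. ennreal (deriv \<Psi> x) \<partial>lborel) \<le> (\<integral>\<^sup>+x. liminf (\<lambda>n. Q n x) \<partial>lborel)"
    using diff
  proof (intro nn_integral_mono_AE, eventually_elim)
    case (elim x)
    show ?case
    proof (cases "x \<in> {a<..<b}")
      case True
      have "eventually (\<lambda>n. x + 1 / real (Suc n) \<in> {a<..<b}) sequentially"
        using True by (rule eventually_shift_in_interval)
      then have "eventually (\<lambda>n. ennreal (real (Suc n) * (\<Psi> (x + 1 / Suc n) - \<Psi> x)) = Q n x) sequentially"
        by (rule eventually_mono) (use True in \<open>simp add: E_def Q_def del: of_nat_Suc\<close>)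
      moreover have "(\<lambda>n. ennreal (real (Suc n) * (\<Psi> (x + 1 / Suc n) - \<Psi> x))) \<longlonglongrightarrow> ennreal (deriv \<Psi> x)"
        using deriv_quotient_tendsto elim True by (intro tendsto_ennrealI) blast
      ultimately have "(\<lambda>n. Q n x) \<longlonglongrightarrow> ennreal (deriv \<Psi> x)"
        by (rule Lim_transform_eventually[rotated])
      then have "liminf (\<lambda>n. Q n x) = ennreal (deriv \<Psi> x)" by (intro lim_imp_Liminf) auto
      then show ?thesis using True by simp
    qed simp
  qed
  also have "\<dots> \<le> liminf (\<lambda>n. \<integral>\<^sup>+x. Q n x \<partial>lborel)"
    by (rule nn_integral_liminf) (simp add: Q_def)
  also have "\<dots> \<le> ennreal B"
    using Q by (intro Liminf_le always_eventually) auto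
  finally show ?thesis .
qed

subsection \<open>The coarea inequality\<close>

lemma open_extension: "open (extension \<epsilon> A)"
proof -
  have "extension \<epsilon> A = (\<Union>y\<in>A. ball y \<epsilon>)" by (auto simp: extension_def dist_commute)
  then show ?thesis by (simp add: open_UN)
qed

lemma LipE:
  assumes "f \<in> Lip"
  obtains C where "0 < C" "\<And>x y. \<bar>f x - f y\<bar> \<le> C * dist x y"
proof -
  obtain C where C: "C-lipschitz_on UNIV f" using assms by (auto simp: Lip_def)
  have "\<bar>f x - f y\<bar> \<le> (C + 1) * dist x y" for x y
    using lipschitz_onD[OF C, of x y] by (simp add: dist_real_def distrib_right add_increasing2)
  then show ?thesis using that lipschitz_on_nonneg[OF C] by (metis add_nonneg_pos zero_less_one)
qed

lemma Lip_continuous: "f \<in> Lip \<Longrightarrow> continuous_on UNIV f"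
  by (auto simp: Lip_def intro: lipschitz_on_continuous_on)

lemma grad_mod_nonneg [simp]: "0 \<le> grad_mod f x"
  by (simp add: grad_mod_def)

lemma
  assumes C: "\<And>x y. \<bar>f x - f y\<bar> \<le> C * dist x y" and "0 \<le> C"
  shows ennreal_grad_mod:
      "ennreal (grad_mod f x) = Limsup (at x) (\<lambda>y. ennreal (\<bar>f x - f y\<bar> / dist x y))" (is "_ = ?L")
    and grad_mod_le: "grad_mod f x \<le> C"
proof -
  have "\<bar>f x - f y\<bar> / dist x y \<le> C" for y
    using C[of x y] \<open>0 \<le> C\<close> by (cases "x = y") (auto simp: field_simps)
  then have L: "?L \<le> ennreal C"
    by (intro Limsup_bounded always_eventually allI ennreal_leI)
  then have "?L < \<infinity>" using ennreal_less_top le_less_trans by fastforce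
  then show "ennreal (grad_mod f x) = ?L" by (simp add: grad_mod_def less_top)
  show "grad_mod f x \<le> C" using enn2real_leI[OF \<open>0 \<le> C\<close> L] by (simp add: grad_mod_def)
qed

lemma grad_mod_local:
  assumes "f \<in> Lip" "grad_mod f x < c"
  obtains d where "0 < d" "\<And>y. dist x y < d \<Longrightarrow> \<bar>f x - f y\<bar> \<le> c * dist x y"
proof -
  obtain C where "0 < C" "\<And>x y. \<bar>f x - f y\<bar> \<le> C * dist x y" using LipE[OF assms(1)] by blast
  then have "Limsup (at x) (\<lambda>y. ennreal (\<bar>f x - f y\<bar> / dist x y)) < ennreal c"
    using ennreal_grad_mod[of f C x] ennreal_lessI[OF _ assms(2)] grad_mod_nonneg[of f x] assms(2) by force
  then have "eventually (\<lambda>y. ennreal (\<bar>f x - f y\<bar> / dist x y) < ennreal c) (at x)"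
    by (rule Limsup_lessD)
  then obtain d where d: "0 < d" "\<And>y. y \<noteq> x \<Longrightarrow> dist y x < d \<Longrightarrow> ennreal (\<bar>f x - f y\<bar> / dist x y) < ennreal c"
    unfolding eventually_at by blast
  show ?thesis
  proof
    show "\<bar>f x - f y\<bar> \<le> c * dist x y" if "dist x y < d" for y
    proof (cases "y = x")
      case False
      then have "\<bar>f x - f y\<bar> / dist x y < c"
        using d(2)[OF False] that by (subst ennreal_less_iff[symmetric]) (auto simp: dist_commute)
      then show ?thesis using False by (simp add: field_simps)
    qed simp
  qed (rule d(1))
qed

text \<open>The upper limit is a countable infimum of suprema over punctured balls. For fixed
  \<open>y\<close> the quotient exceeds \<open>a\<close> on an open set of \<open>x\<close>, so each
  supremum is lower semicontinuous: the union over all \<open>y\<close> is uncountable but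
  open.\<close>

lemma grad_mod_measurable:
  assumes "f \<in> Lip"
  shows "grad_mod f \<in> borel_measurable borel"
proof -
  define q where "q = (\<lambda>x y. ennreal (\<bar>f x - f y\<bar> / dist x y))"
  define g where "g = (\<lambda>n x. SUP y\<in>ball x (1 / real (Suc n)) - {x}. q x y)"
  have "open {x. x \<noteq> y \<and> dist x y < r \<and> a < q x y}" for y r a
  proof -
    have op: "open {x. x \<noteq> y \<and> dist x y < r}"
      by (intro open_Collect_conj open_Collect_neq open_Collect_less continuous_intros)
    have "continuous_on {x. x \<noteq> y \<and> dist x y < r} (\<lambda>x. q x y)"
      unfolding q_def by (intro continuous_on_ennreal continuous_intros
          continuous_on_subset[OF Lip_continuous[OF assms]]) auto
    from continuous_open_preimage[OF this op, of "{a<..}"] show ?thesis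
      by (simp add: vimage_def Int_def conj_assoc)
  qed
  moreover have "{x. a < g n x} = (\<Union>y. {x. x \<noteq> y \<and> dist x y < 1 / real (Suc n) \<and> a < q x y})" for n a
    by (auto simp: g_def less_SUP_iff)
  ultimately have "open {x. a < g n x}" for n a by (simp add: open_UN)
  then have [measurable]: "g n \<in> borel_measurable borel" for n
    by (intro borel_measurableI_greater) auto
  have "Limsup (at x) (q x) = (INF n. g n x)" for x
  proof (rule antisym)
    show "Limsup (at x) (q x) \<le> (INF n. g n x)"
      unfolding Limsup_within g_def by (intro INF_mono) (auto intro!: bexI[of _ "1 / real (Suc _)"])
    show "(INF n. g n x) \<le> Limsup (at x) (q x)"
      unfolding Limsup_within
    proof (rule INF_mono)
      fix e :: real assume "e \<in> {0<..}"
      then obtain n where "1 / real (Suc n) < e" using nat_approx_posE by auto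
      then show "\<exists>n\<in>UNIV. g n x \<le> (SUP y\<in>UNIV \<inter> ball x e - {x}. q x y)"
        unfolding g_def by (intro bexI[of _ n] SUP_subset_mono) auto
    qed
  qed
  then have "grad_mod f = (\<lambda>x. enn2real (INF n. g n x))"
    by (auto simp: grad_mod_def q_def)
  then show ?thesis by simp
qed

lemma nn_integral_incseq_le:
  assumes "incseq A" and [measurable]: "\<And>n. A n \<in> sets N" "g \<in> borel_measurable N"
    and "\<And>n. (\<integral>\<^sup>+x\<in>A n. g x \<partial>N) \<le> K"
  shows "(\<integral>\<^sup>+x\<in>(\<Union>n. A n). g x \<partial>N) \<le> K"
proof -
  have "emeasure (density N g) (\<Union>n. A n) = (SUP n. emeasure (density N g) (A n))"
    using assms(1) by (intro SUP_emeasure_incseq[symmetric]) auto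
  also have "\<dots> \<le> K" using assms(4) by (intro SUP_least) (simp add: emeasure_density)
  finally show ?thesis by (simp add: emeasure_density)
qed

lemma distr_fun_nonneg [simp]: "0 \<le> distr_fun M u t"
  by (simp add: distr_fun_def)

lemma (in finite_measure) distr_fun_antimono:
  assumes "u \<in> borel_measurable M" "s \<le> t"
  shows "distr_fun M u t \<le> distr_fun M u s"
  unfolding distr_fun_def using assms by (intro finite_measure_mono) auto

lemma (in finite_measure) distr_fun_measurable:
  assumes "u \<in> borel_measurable M"
  shows "distr_fun M u \<in> borel_measurable borel"
proof -
  have "(\<lambda>t. - distr_fun M u t) \<in> borel_measurable borel"
    using distr_fun_antimono[OF assms] by (intro borel_measurable_mono monoI) simp
  then show ?thesis by simp
qed

section \<open>From perimeter to the coarea inequality\<close>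

locale isoperimetric_space = prob_space M for M :: "'a::metric_space measure" +
  fixes I :: "real \<Rightarrow> real"
  assumes sets_M [measurable_cong]: "sets M = sets borel"
    and minorant: "isoperimetric_minorant M I"
    and cont: "continuous_on {0..1} I"
begin

lemma space_M: "space M = UNIV"
  using sets_eq_imp_space_eq[OF sets_M] by simp

lemma I_nonneg: "t \<in> {0..1} \<Longrightarrow> 0 \<le> I t"
  using minorant by (simp add: isoperimetric_minorant_def)

lemma Lip_measurable: "f \<in> Lip \<Longrightarrow> f \<in> borel_measurable M"
  using Lip_continuous borel_measurable_continuous_onI measurable_cong_sets[OF sets_M refl] by blast

lemma grad_mod_measurable_M: "f \<in> Lip \<Longrightarrow> grad_mod f \<in> borel_measurable M"
  using grad_mod_measurable measurable_cong_sets[OF sets_M refl] by blast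

lemma distr_fun_range: "distr_fun M u t \<in> {0..1}"
  by (simp add: distr_fun_def)

lemma I_distr_fun_measurable:
  assumes "u \<in> borel_measurable M"
  shows "(\<lambda>t. I (distr_fun M u t)) \<in> borel_measurable borel"
proof -
  have "distr_fun M u \<in> measurable borel (restrict_space borel {0..1})"
    using distr_fun_range distr_fun_measurable[OF assms] by (intro measurable_restrict_space2) auto
  from measurable_compose[OF this borel_measurable_continuous_on_restrict[OF cont]]
  show ?thesis .
qed

text \<open>The lower limit over all radii in \<open>Per\<close> is at most the one along the radii
  1 / (n + 1). A sequence is what Fatou's lemma requires.\<close>

lemma I_le_liminf:
  assumes "A \<in> sets borel"
  shows "ennreal (I (measure M A))
    \<le> liminf (\<lambda>n. ennreal (real (Suc n) * (measure M (extension (1 / Suc n) A) - measure M A)))"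
  unfolding le_Liminf_iff
proof (intro allI impI)
  fix y assume y: "y < ennreal (I (measure M A))"
  then obtain r where r: "y = ennreal r" "0 \<le> r" by (cases y) auto
  have "r < I (measure M A)" using y r by (simp add: ennreal_less_iff)
  moreover have "ereal (I (measure M A)) \<le> Per M A"
    using minorant assms by (auto simp: isoperimetric_minorant_def)
  ultimately have "ereal r < Per M A" by (meson less_ereal.simps(1) less_le_trans)
  then have "eventually (\<lambda>h. ereal r < ereal ((measure M (extension h A) - measure M A) / h)) (at_right 0)"
    unfolding Per_def by (rule less_LiminfD)
  moreover have "filterlim (\<lambda>n. 1 / real (Suc n)) (at_right 0) sequentially"
    using LIMSEQ_inverse_real_of_nat by (simp add: filterlim_at inverse_eq_divide)
  ultimately have "eventually (\<lambda>n. ereal r < ereal ((measure M (extension (1 / Suc n) A) - measure M A) / (1 / Suc n))) sequentially"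
    by (rule eventually_compose_filterlim)
  then show "eventually (\<lambda>n. y < ennreal (real (Suc n) * (measure M (extension (1 / Suc n) A) - measure M A))) sequentially"
    by (rule eventually_mono) (use r in \<open>simp add: ennreal_less_iff mult.commute del: of_nat_Suc\<close>)
qed

text \<open>The superlevel sets of \<open>v n\<close> are the extensions of those of \<open>\<bar>f\<bar>\<close>, so by Fubini the difference
  quotients of the measures of the level sets integrate to those of \<open>\<bar>f\<bar>\<close> itself; Fatou's lemma is
  applied in the level variable and its reverse form in the space variable.\<close>

lemma coarea_closed_window:
  assumes f: "f \<in> Lip"
  shows "(\<integral>\<^sup>+t\<in>{a<..<b}. ennreal (I (distr_fun M f t)) \<partial>lborel)
    \<le> (\<integral>\<^sup>+x\<in>{x. a \<le> \<bar>f x\<bar> \<and> \<bar>f x\<bar> \<le> b}. ennreal (grad_mod f x) \<partial>M)"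
proof -
  obtain C where C: "0 < C" "\<And>x y. \<bar>f x - f y\<bar> \<le> C * dist x y" using LipE[OF f] by blast
  define u where "u = (\<lambda>x. \<bar>f x\<bar>)"
  have uf: "u y \<le> u x + \<bar>f x - f y\<bar>" for x y by (simp add: u_def)
  have uC: "u y \<le> u x + C * dist x y" for x y using uf[of y x] C(2)[of x y] by simp
  have [measurable]: "u \<in> borel_measurable M" "grad_mod f \<in> borel_measurable M"
    using Lip_measurable[OF f] grad_mod_measurable_M[OF f] by (auto simp: u_def)
  define h where "h = (\<lambda>n. 1 / real (Suc n))"
  have h: "0 < h n" for n by (simp add: h_def)
  define v where "v = (\<lambda>n x. SUP y\<in>ball x (h n). u y)"
  have bdd: "bdd_above (u ` ball x (h n))" for n x
  proof (rule bdd_aboveI2)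
    fix y assume "y \<in> ball x (h n)"
    then have "C * dist x y \<le> C * h n" using C(1) by (intro mult_left_mono) auto
    then show "u y \<le> u x + C * h n" using uC[of y x] by simp
  qed
  have ne: "ball x (h n) \<noteq> {}" for n x using h[of n] by simp
  have v_le: "v n x \<le> u x + c * h n"
    if "\<And>y. dist x y < h n \<Longrightarrow> u y \<le> u x + c * dist x y" "0 \<le> c" for n x c
    unfolding v_def
  proof (rule cSUP_least[OF ne])
    fix y assume "y \<in> ball x (h n)"
    then show "u y \<le> u x + c * h n"
      using that(1)[of y] mult_left_mono[of "dist x y" "h n" c] that(2) by simp
  qed
  have v_ge: "u x \<le> v n x" for n x unfolding v_def using bdd h by (intro cSUP_upper) auto
  have v_level: "{x. t < v n x} = extension (h n) {x. t < u x}" for t n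
    using ne bdd by (auto simp: v_def less_cSUP_iff extension_def)
  have [measurable]: "v n \<in> borel_measurable M" for n
  proof -
    have "v n \<in> borel_measurable borel"
      by (intro borel_measurableI_greater) (simp add: v_level borel_open open_extension)
    then show ?thesis using measurable_cong_sets[OF sets_M refl] by blast
  qed
  \<comment> \<open>Integrating over the levels first: the part of \<open>[u x, v n x)\<close>
    inside the window has this length, and \<open>ennreal\<close> makes it 0 when they do not
    meet.\<close>
  define G where "G = (\<lambda>n x. ennreal (real (Suc n) * (min b (v n x) - max a (u x))))"
  have [measurable]: "G n \<in> borel_measurable M" for n unfolding G_def by measurable
  define W where "W = (\<lambda>n t. ennreal (real (Suc n) * (measure M (extension (h n) {x. t < u x}) - distr_fun M f t)))"
  have W: "W n t = ennreal (Suc n) * emeasure M {x\<in>space M. u x \<le> t \<and> t < v n x}" for n t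
  proof -
    have sub: "{x. t < u x} \<subseteq> {x. t < v n x}" using v_ge[of _ n] by (force intro: less_le_trans)
    have "{x. t < u x} \<in> sets M" "{x. t < v n x} \<in> sets M"
      using measurable_sets[of u M borel "{t<..}"] measurable_sets[of "v n" M borel "{t<..}"]
      by (auto simp: vimage_def space_M)
    then have "measure M ({x. t < v n x} - {x. t < u x}) = measure M {x. t < v n x} - measure M {x. t < u x}"
      using sub by (intro finite_measure_Diff)
    moreover have "{x. t < v n x} - {x. t < u x} = {x\<in>space M. u x \<le> t \<and> t < v n x}"
      by (auto simp: space_M)
    moreover have "distr_fun M f t = measure M {x. t < u x}" by (simp add: distr_fun_def u_def space_M)
    ultimately have "W n t = ennreal (real (Suc n) * measure M {x\<in>space M. u x \<le> t \<and> t < v n x})"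
      by (simp add: W_def v_level)
    then show ?thesis by (simp add: ennreal_mult emeasure_eq_measure del: of_nat_Suc)
  qed
  have Wmeas: "W n \<in> borel_measurable borel" for n unfolding W by measurable
  have fubini: "(\<integral>\<^sup>+t\<in>{a<..<b}. W n t \<partial>lborel) = (\<integral>\<^sup>+x. G n x \<partial>M)" for n
  proof -
    interpret P: pair_sigma_finite M lborel ..
    let ?S = "\<lambda>x t. indicator {(x, t). u x \<le> t \<and> t < v n x \<and> a < t \<and> t < b} (x, t) :: ennreal"
    have "(\<integral>\<^sup>+t\<in>{a<..<b}. W n t \<partial>lborel) = (\<integral>\<^sup>+t. ennreal (Suc n) * (\<integral>\<^sup>+x. ?S x t \<partial>M) \<partial>lborel)"
    proof (rule nn_integral_cong)
      fix t
      have "emeasure M {x\<in>space M. u x \<le> t \<and> t < v n x} * indicator {a<..<b} t = (\<integral>\<^sup>+x. ?S x t \<partial>M)"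
        by (subst nn_integral_indicator[symmetric])
          (auto simp: space_M nn_integral_multc[symmetric] indicator_def intro!: nn_integral_cong simp del: nn_integral_indicator)
      then show "W n t * indicator {a<..<b} t = ennreal (Suc n) * (\<integral>\<^sup>+x. ?S x t \<partial>M)"
        by (simp add: W mult.assoc)
    qed
    also have "\<dots> = ennreal (Suc n) * (\<integral>\<^sup>+t. (\<integral>\<^sup>+x. ?S x t \<partial>M) \<partial>lborel)"
      by (rule nn_integral_cmult) measurable
    also have "\<dots> = ennreal (Suc n) * (\<integral>\<^sup>+x. (\<integral>\<^sup>+t. ?S x t \<partial>lborel) \<partial>M)"
      by (subst P.Fubini') auto
    also have "\<dots> = (\<integral>\<^sup>+x. ennreal (Suc n) * (\<integral>\<^sup>+t. ?S x t \<partial>lborel) \<partial>M)"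
      by (rule nn_integral_cmult[symmetric]) measurable
    also have "\<dots> = (\<integral>\<^sup>+x. G n x \<partial>M)"
    proof (rule nn_integral_cong)
      fix x
      have "(\<integral>\<^sup>+t. ?S x t \<partial>lborel) = (\<integral>\<^sup>+t. indicator {max a (u x)..<min b (v n x)} t \<partial>lborel)"
        by (rule nn_integral_cong_AE, rule AE_mp[OF AE_lborel_singleton[of a]])
          (auto simp: indicator_def)
      also have "\<dots> = ennreal (min b (v n x) - max a (u x))"
        by (cases "max a (u x) \<le> min b (v n x)") (auto simp: ennreal_neg)
      finally show "ennreal (Suc n) * (\<integral>\<^sup>+t. ?S x t \<partial>lborel) = G n x"
        by (simp add: G_def ennreal_mult'' [symmetric] ennreal_mult' del: of_nat_Suc)
    qed
    finally show ?thesis .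
  qed
  have Gbd: "G n x \<le> ennreal c" if "v n x \<le> u x + c * h n" "0 \<le> c" for n x c
  proof -
    have "min b (v n x) - max a (u x) \<le> c * h n" using that by linarith
    then have "real (Suc n) * (min b (v n x) - max a (u x)) \<le> real (Suc n) * (c * h n)"
      by (rule mult_left_mono) simp
    then show ?thesis unfolding G_def by (intro ennreal_leI) (simp add: h_def)
  qed
  \<comment> \<open>If |f x| < a, the supremum over small balls is eventually below \<open>a\<close>
    too; if |f x| > b, nothing is left in the window. Points at level \<open>a\<close> must be kept,
    since nearby values above \<open>a\<close> can contribute for every radius.\<close>
  have limG: "limsup (\<lambda>n. G n x) \<le> ennreal (grad_mod f x) * indicator {x. a \<le> \<bar>f x\<bar> \<and> \<bar>f x\<bar> \<le> b} x" for x
  proof -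
    have hlim: "h \<longlonglongrightarrow> 0"
      using LIMSEQ_inverse_real_of_nat by (simp add: h_def[abs_def] inverse_eq_divide)
    consider "u x < a" | "b < u x" | "a \<le> u x" "u x \<le> b" by linarith
    then show ?thesis
    proof cases
      case 1
      have "(\<lambda>n. u x + C * h n) \<longlonglongrightarrow> u x + C * 0" by (intro tendsto_intros hlim)
      then have "eventually (\<lambda>n. u x + C * h n < a) sequentially" using 1 by (intro order_tendstoD) auto
      then have "eventually (\<lambda>n. G n x \<le> 0) sequentially"
      proof (rule eventually_mono)
        fix n assume "u x + C * h n < a"
        then have "min b (v n x) - max a (u x) \<le> 0" using v_le[of x n C] uC C(1) by force
        then show "G n x \<le> 0"
          by (simp add: G_def ennreal_neg mult_nonneg_nonpos del: of_nat_Suc)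
      qed
      then have "limsup (\<lambda>n. G n x) \<le> 0" by (rule Limsup_bounded)
      then show ?thesis by simp
    next
      case 2
      then have "min b (v n x) - max a (u x) \<le> 0" for n by linarith
      then have "G n x \<le> 0" for n
        by (simp add: G_def ennreal_neg mult_nonneg_nonpos del: of_nat_Suc)
      then have "limsup (\<lambda>n. G n x) \<le> 0" by (intro Limsup_bounded) simp
      then show ?thesis by simp
    next
      case 3
      have "limsup (\<lambda>n. G n x) \<le> ennreal (grad_mod f x)"
      proof (rule ennreal_le_epsilon)
        fix e :: real assume "0 < e"
        define c where "c = grad_mod f x + e"
        have c: "0 \<le> c" "grad_mod f x < c" using \<open>0 < e\<close> by (auto simp: c_def add_nonneg_nonneg)
        obtain d where d: "0 < d" "\<And>y. dist x y < d \<Longrightarrow> \<bar>f x - f y\<bar> \<le> c * dist x y"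
          using grad_mod_local[OF f c(2)] by blast
        have "eventually (\<lambda>n. h n < d) sequentially" using hlim d(1) by (rule order_tendstoD)
        then have "eventually (\<lambda>n. G n x \<le> ennreal c) sequentially"
        proof (rule eventually_mono)
          fix n assume "h n < d"
          then have "u y \<le> u x + c * dist x y" if "dist x y < h n" for y
            using that uf[of y x] d(2)[of y] by simp
          then show "G n x \<le> ennreal c" using c(1) by (intro Gbd v_le)
        qed
        then have "limsup (\<lambda>n. G n x) \<le> ennreal c" by (rule Limsup_bounded)
        then show "limsup (\<lambda>n. G n x) \<le> ennreal (grad_mod f x) + ennreal e"
          using \<open>0 < e\<close> by (simp add: c_def)
      qed
      then show ?thesis using 3 by (simp add: u_def)
    qed
  qed
  have "(\<integral>\<^sup>+t\<in>{a<..<b}. ennreal (I (distr_fun M f t)) \<partial>lborel)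
      \<le> (\<integral>\<^sup>+t. liminf (\<lambda>n. W n t * indicator {a<..<b} t) \<partial>lborel)"
  proof (rule nn_integral_mono)
    fix t
    have "{x. t < u x} \<in> sets borel"
      using measurable_sets[of u M borel "{t<..}"] sets_M by (auto simp: vimage_def space_M)
    from I_le_liminf[OF this] have "ennreal (I (distr_fun M f t)) \<le> liminf (\<lambda>n. W n t)"
      by (simp add: W_def h_def distr_fun_def u_def space_M)
    then show "ennreal (I (distr_fun M f t)) * indicator {a<..<b} t \<le> liminf (\<lambda>n. W n t * indicator {a<..<b} t)"
      by (auto simp: indicator_def)
  qed
  also have "\<dots> \<le> liminf (\<lambda>n. \<integral>\<^sup>+t\<in>{a<..<b}. W n t \<partial>lborel)"
    by (rule nn_integral_liminf) (use Wmeas in measurable)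
  also have "\<dots> \<le> limsup (\<lambda>n. \<integral>\<^sup>+x. G n x \<partial>M)"
    unfolding fubini by (rule Liminf_le_Limsup) simp
  also have "\<dots> \<le> (\<integral>\<^sup>+x. limsup (\<lambda>n. G n x) \<partial>M)"
  \<comment> \<open>The Lipschitz constant dominates all quotients and is integrable over a
    probability space.\<close>
  proof (rule nn_integral_limsup[where w = "\<lambda>_. ennreal C"])
    show "AE x in M. G n x \<le> ennreal C" for n
      using C(1) uC by (intro AE_I2 Gbd v_le) auto
    show "(\<integral>\<^sup>+x. ennreal C \<partial>M) < \<infinity>" by (simp add: emeasure_space_1)
  qed auto
  also have "\<dots> \<le> (\<integral>\<^sup>+x\<in>{x. a \<le> \<bar>f x\<bar> \<and> \<bar>f x\<bar> \<le> b}. ennreal (grad_mod f x) \<partial>M)"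
    by (intro nn_integral_mono limG)
  finally show ?thesis .
qed

text \<open>The level set of |f| at \<open>a\<close> may carry gradient mass. Exhausting the window
  from inside, with lower ends decreasing to \<open>a\<close>, excludes it, so that the domain of
  integration becomes a difference of two strict superlevel sets.\<close>

lemma coarea_window:
  assumes f: "f \<in> Lip"
  shows "(\<integral>\<^sup>+t\<in>{a<..<b}. ennreal (I (distr_fun M f t)) \<partial>lborel)
    \<le> (\<integral>\<^sup>+x\<in>{x. a < \<bar>f x\<bar> \<and> \<bar>f x\<bar> \<le> b}. ennreal (grad_mod f x) \<partial>M)" (is ?win)
    and coarea_above: "(\<integral>\<^sup>+t\<in>{a<..}. ennreal (I (distr_fun M f t)) \<partial>lborel)
    \<le> (\<integral>\<^sup>+x\<in>{x. a < \<bar>f x\<bar>}. ennreal (grad_mod f x) \<partial>M)" (is ?above)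
proof -
  note [measurable] = I_distr_fun_measurable[OF Lip_measurable[OF f]]
  define c where "c = (\<lambda>n. a + 1 / real (Suc n))"
  have c: "a < c n" for n by (simp add: c_def)
  have c_dec: "c n \<le> c m" if "m \<le> n" for m n using that by (auto simp: c_def frac_le)
  have c_ex: "\<exists>n. c n < t" if "a < t" for t
    using nat_approx_posE[of "t - a"] that unfolding c_def by (metis diff_gt_0_iff_gt less_diff_eq add.commute)
  have win: "(\<integral>\<^sup>+t\<in>(\<Union>n. {c n<..<b}). ennreal (I (distr_fun M f t)) \<partial>lborel)
    \<le> (\<integral>\<^sup>+x\<in>{x. a < \<bar>f x\<bar> \<and> \<bar>f x\<bar> \<le> b}. ennreal (grad_mod f x) \<partial>M)" for b
  proof (rule nn_integral_incseq_le)
    show "incseq (\<lambda>n. {c n<..<b})" using c_dec by (fastforce simp: incseq_def intro: le_less_trans)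
    show "(\<integral>\<^sup>+t\<in>{c n<..<b}. ennreal (I (distr_fun M f t)) \<partial>lborel)
      \<le> (\<integral>\<^sup>+x\<in>{x. a < \<bar>f x\<bar> \<and> \<bar>f x\<bar> \<le> b}. ennreal (grad_mod f x) \<partial>M)" for n
      using c[of n] by (intro order_trans[OF coarea_closed_window[OF f]] nn_integral_mono)
        (auto simp: indicator_def)
  qed auto
  moreover have "(\<Union>n. {c n<..<b}) = {a<..<b}" for b
    using c_ex less_trans[OF c] by auto
  ultimately have win': "(\<integral>\<^sup>+t\<in>{a<..<b}. ennreal (I (distr_fun M f t)) \<partial>lborel)
    \<le> (\<integral>\<^sup>+x\<in>{x. a < \<bar>f x\<bar> \<and> \<bar>f x\<bar> \<le> b}. ennreal (grad_mod f x) \<partial>M)" for b by simp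
  then show ?win .
  have "(\<integral>\<^sup>+t\<in>(\<Union>n. {a<..<real n}). ennreal (I (distr_fun M f t)) \<partial>lborel)
    \<le> (\<integral>\<^sup>+x\<in>{x. a < \<bar>f x\<bar>}. ennreal (grad_mod f x) \<partial>M)"
  proof (rule nn_integral_incseq_le)
    show "incseq (\<lambda>n. {a<..<real n})" by (auto simp: incseq_def)
    show "(\<integral>\<^sup>+t\<in>{a<..<real n}. ennreal (I (distr_fun M f t)) \<partial>lborel)
      \<le> (\<integral>\<^sup>+x\<in>{x. a < \<bar>f x\<bar>}. ennreal (grad_mod f x) \<partial>M)" for n
      by (intro order_trans[OF win'] nn_integral_mono) (auto simp: indicator_def)
  qed auto
  moreover have "(\<Union>n. {a<..<real n}) = {a<..}" using reals_Archimedean2 by auto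
  ultimately show ?above by simp
qed

end

subsection \<open>Layer cake formulas for rearrangements\<close>

text \<open>Fubini for the region between the level \<open>c\<close> and the graph of
  \<open>w\<close>; \<open>ennreal\<close> takes the positive part of the difference.\<close>

lemma (in sigma_finite_measure) layer_cake:
  fixes w :: "'a \<Rightarrow> real"
  assumes [measurable]: "w \<in> borel_measurable M"
  shows "(\<integral>\<^sup>+x. ennreal (w x - c) \<partial>M)
    = (\<integral>\<^sup>+t\<in>{c<..}. emeasure M {x\<in>space M. t < w x} \<partial>lborel)"
proof -
  interpret P: pair_sigma_finite M lborel ..
  let ?S = "\<lambda>x t. indicator {(x, t). c < t \<and> t < w x} (x, t) :: ennreal"
  have "(\<integral>\<^sup>+t. ?S x t \<partial>lborel) = ennreal (w x - c)" for x
  proof -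
    have "(\<integral>\<^sup>+t. ?S x t \<partial>lborel) = (\<integral>\<^sup>+t. indicator {c<..<w x} t \<partial>lborel)"
      by (intro nn_integral_cong) (auto simp: indicator_def)
    then show ?thesis by (cases "c \<le> w x") (auto simp: ennreal_neg)
  qed
  then have "(\<integral>\<^sup>+x. ennreal (w x - c) \<partial>M) = (\<integral>\<^sup>+x. (\<integral>\<^sup>+t. ?S x t \<partial>lborel) \<partial>M)" by simp
  also have "\<dots> = (\<integral>\<^sup>+t. (\<integral>\<^sup>+x. ?S x t \<partial>M) \<partial>lborel)"
    by (rule P.Fubini'[symmetric]) measurable
  also have "\<dots> = (\<integral>\<^sup>+t\<in>{c<..}. emeasure M {x\<in>space M. t < w x} \<partial>lborel)"
  proof (rule nn_integral_cong)
    fix t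
    show "(\<integral>\<^sup>+x. ?S x t \<partial>M) = emeasure M {x\<in>space M. t < w x} * indicator {c<..} t"
      by (subst nn_integral_indicator[symmetric])
        (auto simp: nn_integral_multc[symmetric] indicator_def intro!: nn_integral_cong simp del: nn_integral_indicator)
  qed
  finally show ?thesis .
qed

context finite_measure
begin

text \<open>Right-continuity in one-sided form: a strict superlevel set is the increasing union of
  those at slightly higher levels.\<close>

lemma distr_fun_right_limit:
  assumes [measurable]: "u \<in> borel_measurable M" and "\<And>s. t < s \<Longrightarrow> distr_fun M u s \<le> c"
  shows "distr_fun M u t \<le> c"
proof -
  define A where "A = (\<lambda>n. {x\<in>space M. t + 1 / real (Suc n) < \<bar>u x\<bar>})"
  have "t + 1 / real (Suc n) \<le> t + 1 / real (Suc m)" if "m \<le> n" for m n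
    using that by (simp add: frac_le)
  then have "incseq A" unfolding A_def incseq_def by (fastforce intro: le_less_trans)
  moreover have "A n \<in> sets M" for n unfolding A_def by measurable
  ultimately have "(\<lambda>n. measure M (A n)) \<longlonglongrightarrow> measure M (\<Union>n. A n)"
    by (intro finite_Lim_measure_incseq) auto
  moreover have "(\<Union>n. A n) = {x\<in>space M. t < \<bar>u x\<bar>}"
  proof -
    have "\<exists>n. t + 1 / real (Suc n) < r" if "t < r" for r
      using nat_approx_posE[of "r - t"] that by (metis diff_gt_0_iff_gt less_diff_eq add.commute)
    moreover have "t < r" if "t + 1 / real (Suc n) < r" for r n
      using that by (rule less_trans[rotated]) simp
    ultimately show ?thesis unfolding A_def by blast
  qed
  moreover have "measure M (A n) \<le> c" for n
    using assms(2)[of "t + 1 / real (Suc n)"] by (simp add: A_def distr_fun_def)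
  ultimately show ?thesis
    unfolding distr_fun_def by (metis (no_types, lifting) LIMSEQ_le_const2)
qed

lemma distr_fun_eventually_small:
  assumes [measurable]: "u \<in> borel_measurable M" and "0 < s"
  shows "\<exists>t\<ge>0. distr_fun M u t \<le> s"
proof -
  define A where "A = (\<lambda>n. {x\<in>space M. real n < \<bar>u x\<bar>})"
  have "decseq A" unfolding A_def decseq_def by force
  moreover have "A n \<in> sets M" for n unfolding A_def by measurable
  ultimately have "(\<lambda>n. measure M (A n)) \<longlonglongrightarrow> measure M (\<Inter>n. A n)"
    by (intro finite_Lim_measure_decseq) auto
  moreover have "(\<Inter>n. A n) = {}"
    unfolding A_def by (auto simp: not_less) (meson not_less real_arch_simple)
  ultimately have "(\<lambda>n. measure M (A n)) \<longlonglongrightarrow> 0" by simp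
  then have "eventually (\<lambda>n. measure M (A n) < s) sequentially"
    using \<open>0 < s\<close> by (rule order_tendstoD)
  then obtain n where "measure M (A n) < s" using eventually_happens by force
  then show ?thesis by (intro exI[of _ "real n"]) (simp add: A_def distr_fun_def)
qed

text \<open>By right-continuity the infimum defining the rearrangement is attained, so rearrangement
  and distribution function are generalised inverses. For s > 0 the infimum is over a nonempty set
  even if \<open>u\<close> is unbounded.\<close>

lemma rearr_le_iff:
  assumes u: "u \<in> borel_measurable M" and "0 \<le> t" "0 < s"
  shows "rearr M u s \<le> t \<longleftrightarrow> distr_fun M u t \<le> s"
proof
  have bdd: "bdd_below {t. 0 \<le> t \<and> distr_fun M u t \<le> s}" by (rule bdd_belowI[of _ 0]) auto
  show "rearr M u s \<le> t" if "distr_fun M u t \<le> s"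
    unfolding rearr_def using that \<open>0 \<le> t\<close> bdd by (intro cInf_lower) auto
  show "distr_fun M u t \<le> s" if "rearr M u s \<le> t"
  proof (rule distr_fun_right_limit[OF u])
    fix r assume "t < r"
    then have "Inf {t. 0 \<le> t \<and> distr_fun M u t \<le> s} < r" using that by (simp add: rearr_def)
    moreover have "{t. 0 \<le> t \<and> distr_fun M u t \<le> s} \<noteq> {}"
      using distr_fun_eventually_small[OF u \<open>0 < s\<close>] by auto
    ultimately have "\<exists>q\<in>{t. 0 \<le> t \<and> distr_fun M u t \<le> s}. q < r" by (rule cInf_lessD[rotated])
    then obtain q where "distr_fun M u q \<le> s" "q < r" by blast
    then show "distr_fun M u r \<le> s" using distr_fun_antimono[OF u, of q r] by simp
  qed
qed

lemma rearr_nonneg: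
  assumes "u \<in> borel_measurable M" "0 < s"
  shows "0 \<le> rearr M u s"
  unfolding rearr_def using distr_fun_eventually_small[OF assms] by (intro cInf_greatest) auto

lemma rearr_antimono:
  assumes "u \<in> borel_measurable M" "0 < s" "s \<le> s'"
  shows "rearr M u s' \<le> rearr M u s"
proof -
  have "0 \<le> rearr M u s" using assms rearr_nonneg by blast
  then have "distr_fun M u (rearr M u s) \<le> s" using rearr_le_iff[OF assms(1) _ assms(2)] by blast
  then show ?thesis
    using rearr_le_iff[OF assms(1) \<open>0 \<le> rearr M u s\<close>, of s'] assms by simp
qed

lemma distr_fun_rearr_le:
  assumes "u \<in> borel_measurable M" "0 < s"
  shows "distr_fun M u (rearr M u s) \<le> s"
  using rearr_le_iff[OF assms(1) rearr_nonneg[OF assms] assms(2)] by simp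

lemma rearr_measurable:
  assumes u: "u \<in> borel_measurable M"
  shows "rearr M u \<in> borel_measurable (restrict_space borel {0<..<t})"
proof -
  have "mono_on {0<..<t} (\<lambda>s. - rearr M u s)"
    using rearr_antimono[OF u] by (intro mono_onI) auto
  then have "(\<lambda>s. - rearr M u s) \<in> borel_measurable (restrict_space borel {0<..<t})"
    by (rule borel_measurable_mono_on_fnc)
  then show ?thesis by simp
qed

lemma rearr_cut_measurable:
  assumes u: "u \<in> borel_measurable M"
  shows "(\<lambda>s. if s \<in> {0<..<t} then rearr M u s else c) \<in> borel_measurable borel"
  using rearr_measurable[OF u, of t]
  by (subst measurable_If_restrict_space_iff) (simp_all only: Collect_mem_eq, auto)

lemma rearr_layer_cake:
  assumes u: "u \<in> borel_measurable M" and "0 \<le> c" "0 < t"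
  shows "(\<integral>\<^sup>+s\<in>{0<..<t}. ennreal (rearr M u s - c) \<partial>lborel)
    = (\<integral>\<^sup>+\<tau>\<in>{c<..}. ennreal (min t (distr_fun M u \<tau>)) \<partial>lborel)"
proof -
  \<comment> \<open>The default value \<open>c\<close> has no excess over \<open>c\<close>, so the
    integral over (0,t) becomes one over the whole line.\<close>
  define w where "w = (\<lambda>s. if s \<in> {0<..<t} then rearr M u s else c)"
  have [measurable]: "w \<in> borel_measurable borel"
    unfolding w_def by (rule rearr_cut_measurable[OF u])
  have "(\<integral>\<^sup>+s\<in>{0<..<t}. ennreal (rearr M u s - c) \<partial>lborel) = (\<integral>\<^sup>+s. ennreal (w s - c) \<partial>lborel)"
    by (intro nn_integral_cong) (auto simp: w_def indicator_def)
  also have "\<dots> = (\<integral>\<^sup>+\<tau>\<in>{c<..}. emeasure lborel {s\<in>space lborel. \<tau> < w s} \<partial>lborel)"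
    by (rule lborel.layer_cake) measurable
  also have "\<dots> = (\<integral>\<^sup>+\<tau>\<in>{c<..}. ennreal (min t (distr_fun M u \<tau>)) \<partial>lborel)"
  proof (intro nn_integral_cong)
    fix \<tau>
    have "emeasure lborel {s\<in>space lborel. \<tau> < w s} = ennreal (min t (distr_fun M u \<tau>))" if "c < \<tau>"
    proof -
      have "\<tau> < rearr M u s \<longleftrightarrow> s < distr_fun M u \<tau>" if "0 < s" for s
        using rearr_le_iff[OF u, of \<tau> s] \<open>0 \<le> c\<close> \<open>c < \<tau>\<close> that by auto
      then have "{s\<in>space lborel. \<tau> < w s} = {0<..<min t (distr_fun M u \<tau>)}"
        using that by (auto simp: w_def)
      then show ?thesis using \<open>0 < t\<close> by simp
    qed
    then show "emeasure lborel {s\<in>space lborel. \<tau> < w s} * indicator {c<..} \<tau>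
      = ennreal (min t (distr_fun M u \<tau>)) * indicator {c<..} \<tau>"
      by (auto simp: indicator_def)
  qed
  finally show ?thesis .
qed

lemma distr_fun_layer_cake:
  assumes [measurable]: "u \<in> borel_measurable M"
  shows "(\<integral>\<^sup>+x. ennreal (\<bar>u x\<bar> - c) \<partial>M) = (\<integral>\<^sup>+\<tau>\<in>{c<..}. ennreal (distr_fun M u \<tau>) \<partial>lborel)"
  by (subst layer_cake) (auto simp: distr_fun_def emeasure_eq_measure)

text \<open>For every level \<open>c\<close> the integral of the rearrangement is at most \<open>c t\<close> plus the integral of
  the excess over \<open>c\<close>, with equality at the level \<open>c = u\<^sup>*(t)\<close>. Comparing the rearrangements of two
  functions thus reduces to comparing their excesses.\<close>

lemma nn_integral_rearr_add:
  assumes u: "u \<in> borel_measurable M" and "0 \<le> c" "0 < t"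
  shows "(\<integral>\<^sup>+s\<in>{0<..<t}. ennreal (max c (rearr M u s)) \<partial>lborel)
    = ennreal (c * t) + (\<integral>\<^sup>+s\<in>{0<..<t}. ennreal (rearr M u s - c) \<partial>lborel)"
proof -
  define w where "w = (\<lambda>s. if s \<in> {0<..<t} then rearr M u s else c)"
  have [measurable]: "w \<in> borel_measurable borel"
    unfolding w_def by (rule rearr_cut_measurable[OF u])
  have "ennreal (max c r) = ennreal c + ennreal (r - c)" for r
    using \<open>0 \<le> c\<close> by (cases "c \<le> r") (auto simp: ennreal_plus[symmetric] ennreal_neg max_def simp del: ennreal_plus)
  then have "(\<integral>\<^sup>+s\<in>{0<..<t}. ennreal (max c (rearr M u s)) \<partial>lborel)
      = (\<integral>\<^sup>+s. ennreal c * indicator {0<..<t} s + ennreal (w s - c) \<partial>lborel)"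
    by (intro nn_integral_cong) (auto simp: w_def indicator_def)
  also have "\<dots> = ennreal (c * t) + (\<integral>\<^sup>+s. ennreal (w s - c) \<partial>lborel)"
    using assms by (subst nn_integral_add) (auto simp: nn_integral_cmult ennreal_mult)
  also have "(\<integral>\<^sup>+s. ennreal (w s - c) \<partial>lborel) = (\<integral>\<^sup>+s\<in>{0<..<t}. ennreal (rearr M u s - c) \<partial>lborel)"
    by (intro nn_integral_cong) (auto simp: w_def indicator_def)
  finally show ?thesis .
qed

lemma nn_integral_rearr_le:
  assumes u: "u \<in> borel_measurable M" and "0 \<le> c" "0 < t"
  shows "(\<integral>\<^sup>+s\<in>{0<..<t}. ennreal (rearr M u s) \<partial>lborel)
    \<le> ennreal (c * t) + (\<integral>\<^sup>+x. ennreal (\<bar>u x\<bar> - c) \<partial>M)"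
proof -
  have "(\<integral>\<^sup>+s\<in>{0<..<t}. ennreal (rearr M u s) \<partial>lborel)
      \<le> (\<integral>\<^sup>+s\<in>{0<..<t}. ennreal (max c (rearr M u s)) \<partial>lborel)"
    by (intro nn_integral_mono mult_right_mono ennreal_leI) auto
  also have "\<dots> = ennreal (c * t) + (\<integral>\<^sup>+\<tau>\<in>{c<..}. ennreal (min t (distr_fun M u \<tau>)) \<partial>lborel)"
    using nn_integral_rearr_add[OF assms] rearr_layer_cake[OF assms] by simp
  also have "\<dots> \<le> ennreal (c * t) + (\<integral>\<^sup>+x. ennreal (\<bar>u x\<bar> - c) \<partial>M)"
    unfolding distr_fun_layer_cake[OF u]
    by (intro add_left_mono nn_integral_mono mult_right_mono ennreal_leI) auto
  finally show ?thesis .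
qed

lemma nn_integral_rearr_eq:
  assumes u: "u \<in> borel_measurable M" and "0 < t"
  defines "c \<equiv> rearr M u t"
  shows "(\<integral>\<^sup>+s\<in>{0<..<t}. ennreal (rearr M u s) \<partial>lborel)
    = ennreal (c * t) + (\<integral>\<^sup>+x. ennreal (\<bar>u x\<bar> - c) \<partial>M)"
proof -
  have "0 \<le> c" unfolding c_def using u \<open>0 < t\<close> by (rule rearr_nonneg)
  have small: "distr_fun M u \<tau> \<le> t" if "c < \<tau>" for \<tau>
    using distr_fun_rearr_le[OF u \<open>0 < t\<close>] distr_fun_antimono[OF u, of c \<tau>] that by (simp add: c_def)
  have "(\<integral>\<^sup>+s\<in>{0<..<t}. ennreal (rearr M u s) \<partial>lborel)
      = (\<integral>\<^sup>+s\<in>{0<..<t}. ennreal (max c (rearr M u s)) \<partial>lborel)"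
    using rearr_antimono[OF u] unfolding c_def
    by (intro nn_integral_cong) (auto simp: indicator_def max_def intro!: arg_cong[where f = ennreal] antisym)
  also have "\<dots> = ennreal (c * t) + (\<integral>\<^sup>+\<tau>\<in>{c<..}. ennreal (min t (distr_fun M u \<tau>)) \<partial>lborel)"
    using nn_integral_rearr_add[OF u \<open>0 \<le> c\<close> \<open>0 < t\<close>] rearr_layer_cake[OF u \<open>0 \<le> c\<close> \<open>0 < t\<close>] by simp
  also have "(\<integral>\<^sup>+\<tau>\<in>{c<..}. ennreal (min t (distr_fun M u \<tau>)) \<partial>lborel) = (\<integral>\<^sup>+x. ennreal (\<bar>u x\<bar> - c) \<partial>M)"
    unfolding distr_fun_layer_cake[OF u] using small
    by (intro nn_integral_cong) (auto simp: indicator_def)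
  finally show ?thesis .
qed

text \<open>A Hardy-Littlewood bound: on \<open>A\<close> the function is at most \<open>c\<close>
  plus its excess over \<open>c\<close>, and at c = \<open>rearr M u t\<close> the resulting bound
  is exactly the right-hand side.\<close>

lemma nn_integral_set_le_rearr:
  assumes u: "u \<in> borel_measurable M" and A: "A \<in> sets M" "measure M A \<le> t" and "0 < t"
  shows "(\<integral>\<^sup>+x\<in>A. ennreal \<bar>u x\<bar> \<partial>M) \<le> (\<integral>\<^sup>+s\<in>{0<..<t}. ennreal (rearr M u s) \<partial>lborel)"
proof -
  note [measurable] = u A(1)
  define c where "c = rearr M u t"
  have "0 \<le> c" unfolding c_def using u \<open>0 < t\<close> by (rule rearr_nonneg)
  have "ennreal \<bar>r\<bar> \<le> ennreal c + ennreal (\<bar>r\<bar> - c)" for r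
    using \<open>0 \<le> c\<close> by (cases "c \<le> \<bar>r\<bar>")
      (auto simp: ennreal_plus[symmetric] ennreal_neg intro!: ennreal_leI simp del: ennreal_plus)
  then have "(\<integral>\<^sup>+x\<in>A. ennreal \<bar>u x\<bar> \<partial>M)
      \<le> (\<integral>\<^sup>+x. ennreal c * indicator A x + ennreal (\<bar>u x\<bar> - c) \<partial>M)"
    by (intro nn_integral_mono) (auto simp: indicator_def)
  also have "\<dots> = ennreal (c * measure M A) + (\<integral>\<^sup>+x. ennreal (\<bar>u x\<bar> - c) \<partial>M)"
    using \<open>0 \<le> c\<close> by (subst nn_integral_add) (auto simp: nn_integral_cmult ennreal_mult emeasure_eq_measure)
  also have "\<dots> \<le> ennreal (c * t) + (\<integral>\<^sup>+x. ennreal (\<bar>u x\<bar> - c) \<partial>M)"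
    using \<open>0 \<le> c\<close> A(2) by (intro add_right_mono ennreal_leI mult_left_mono)
  also have "\<dots> = (\<integral>\<^sup>+s\<in>{0<..<t}. ennreal (rearr M u s) \<partial>lborel)"
    unfolding c_def using nn_integral_rearr_eq[OF u \<open>0 < t\<close>] by simp
  finally show ?thesis .
qed

end

subsection \<open>Rearrangements of Lipschitz functions\<close>

text \<open>Increments are controlled only through a lower bound \<open>m\<close> of
  \<open>J\<close> on the interval. Continuity admits m = J s - e for short intervals, and
  \<open>e\<close> tends to 0 after the passage to derivatives. With \<Phi> abstract, the lemma
  serves both the gradient integral and the integral of the excess plus a linear term.\<close>

lemma deriv_mult_le:
  fixes F \<Phi> J :: "real \<Rightarrow> real"
  assumes diff: "F differentiable (at s)" "\<Phi> differentiable (at s)" and "isCont J s" "s < b"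
    and incr: "\<And>s' m. s < s' \<Longrightarrow> s' < b \<Longrightarrow> (\<And>r. r \<in> {s..s'} \<Longrightarrow> m \<le> J r)
          \<Longrightarrow> (F s - F s') * m \<le> \<Phi> s' - \<Phi> s"
  shows "- deriv F s * J s \<le> deriv \<Phi> s"
proof -
  have lim: "- deriv F s * (J s - e) \<le> deriv \<Phi> s" if "0 < e" for e
  proof -
    obtain d where d: "0 < d" "\<And>r. \<bar>r - s\<bar> < d \<Longrightarrow> J s - e \<le> J r"
      using \<open>isCont J s\<close> \<open>0 < e\<close> unfolding continuous_at_eps_delta dist_real_def
      by (metis abs_diff_less_iff less_imp_le)
    define c where "c = min b (s + d)"
    have "s \<in> {s - 1<..<c}" using \<open>s < b\<close> d(1) by (simp add: c_def)
    then have "eventually (\<lambda>n. s + 1 / real (Suc n) \<in> {s - 1<..<c}) sequentially"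
      by (rule eventually_shift_in_interval)
    then have "eventually (\<lambda>n. real (Suc n) * (F (s + 1 / Suc n) - F s) * - (J s - e)
        \<le> real (Suc n) * (\<Phi> (s + 1 / Suc n) - \<Phi> s)) sequentially"
    proof (rule eventually_mono)
      fix n assume n: "s + 1 / real (Suc n) \<in> {s - 1<..<c}"
      have "(F s - F (s + 1 / Suc n)) * (J s - e) \<le> \<Phi> (s + 1 / Suc n) - \<Phi> s"
      proof (rule incr)
        show "J s - e \<le> J r" if "r \<in> {s..s + 1 / real (Suc n)}" for r
          using that n by (intro d(2)) (auto simp: c_def)
      qed (use n in \<open>auto simp: c_def\<close>)
      then have "real (Suc n) * ((F s - F (s + 1 / Suc n)) * (J s - e)) \<le> real (Suc n) * (\<Phi> (s + 1 / Suc n) - \<Phi> s)"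
        by (rule mult_left_mono) simp
      then show "real (Suc n) * (F (s + 1 / Suc n) - F s) * - (J s - e)
        \<le> real (Suc n) * (\<Phi> (s + 1 / Suc n) - \<Phi> s)"
        by (simp add: algebra_simps del: of_nat_Suc)
    qed
    moreover have "(\<lambda>n. real (Suc n) * (F (s + 1 / Suc n) - F s) * - (J s - e)) \<longlonglongrightarrow> deriv F s * - (J s - e)"
      by (intro tendsto_mult_right deriv_quotient_tendsto diff)
    ultimately have "deriv F s * - (J s - e) \<le> deriv \<Phi> s"
      using tendsto_le[OF sequentially_bot deriv_quotient_tendsto[OF diff(2)]] by blast
    then show ?thesis by (simp add: algebra_simps)
  qed
  have "((\<lambda>e. - deriv F s * (J s - e)) \<longlongrightarrow> - deriv F s * (J s - 0)) (at_right 0)"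
    by (intro tendsto_intros)
  moreover have "eventually (\<lambda>e. - deriv F s * (J s - e) \<le> deriv \<Phi> s) (at_right 0)"
    using lim by (simp add: eventually_at_right_less eventually_at_filter)
  ultimately show ?thesis
    using tendsto_upperbound[of "\<lambda>e. - deriv F s * (J s - e)" "- deriv F s * (J s - 0)" "at_right 0" "deriv \<Phi> s"]
    by simp
qed

context isoperimetric_space
begin

context
  fixes f :: "'a \<Rightarrow> real" assumes f: "f \<in> Lip"
begin

lemmas f_measurable [measurable] = Lip_measurable[OF f]

text \<open>The weight \<open>k\<close> will be the gradient for (ii) and its excess over a level
  for (iii).\<close>

lemma superlevel_integral_diff:
  assumes k: "integrable M k" "\<And>x. 0 \<le> k x" and s: "0 < s" "s \<le> s'"
  defines "\<Psi> \<equiv> \<lambda>s. LINT x:{x. rearr M f s < \<bar>f x\<bar>}|M. k x"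
  shows "\<Psi> s \<le> \<Psi> s'"
    and "ennreal (\<Psi> s' - \<Psi> s) = (\<integral>\<^sup>+x\<in>{x. rearr M f s' < \<bar>f x\<bar> \<and> \<bar>f x\<bar> \<le> rearr M f s}. ennreal (k x) \<partial>M)"
proof -
  let ?D = "{x. rearr M f s' < \<bar>f x\<bar> \<and> \<bar>f x\<bar> \<le> rearr M f s}"
  have le: "rearr M f s' \<le> rearr M f s" using rearr_antimono[OF f_measurable s] .
  have sets: "{x. a < \<bar>f x\<bar>} \<in> sets M" "?D \<in> sets M" for a
    using measurable_sets[OF f_measurable, of "{x. a < \<bar>x\<bar>}"]
      measurable_sets[OF f_measurable, of "{x. rearr M f s' < \<bar>x\<bar> \<and> \<bar>x\<bar> \<le> rearr M f s}"]
    by (auto simp: vimage_def space_M)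
  have int: "set_integrable M A k" if "A \<in> sets M" for A
    unfolding set_integrable_def using k(1) that by (intro integrable_mult_indicator)
  have "{x. rearr M f s' < \<bar>f x\<bar>} = {x. rearr M f s < \<bar>f x\<bar>} \<union> ?D" using le by auto
  then have eq: "\<Psi> s' = \<Psi> s + (LINT x:?D|M. k x)"
    unfolding \<Psi>_def by (simp only:) (rule set_integral_Un, use int sets in auto)
  have nn: "0 \<le> (LINT x:?D|M. k x)"
    unfolding set_lebesgue_integral_def using k(2) by (intro integral_nonneg_AE) auto
  with eq show "\<Psi> s \<le> \<Psi> s'" by simp
  have "ennreal (LINT x:?D|M. k x) = (\<integral>\<^sup>+x. ennreal (indicator ?D x *\<^sub>R k x) \<partial>M)"
    unfolding set_lebesgue_integral_def using int[OF sets(2)] k(2)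
    by (intro nn_integral_eq_integral[symmetric]) (auto simp: set_integrable_def)
  also have "\<dots> = (\<integral>\<^sup>+x\<in>?D. ennreal (k x) \<partial>M)"
    by (intro nn_integral_cong) (auto simp: indicator_def)
  finally show "ennreal (\<Psi> s' - \<Psi> s) = (\<integral>\<^sup>+x\<in>?D. ennreal (k x) \<partial>M)" using eq by simp
qed

lemma grad_mod_integrable: "integrable M (grad_mod f)"
proof -
  obtain C where "0 < C" "\<And>x y. \<bar>f x - f y\<bar> \<le> C * dist x y" using LipE[OF f] by blast
  then have "grad_mod f x \<le> C" for x by (intro grad_mod_le) auto
  then show ?thesis
    using grad_mod_measurable_M[OF f] by (intro integrable_const_bound[of _ C]) auto
qed

lemma distr_fun_between:
  assumes "0 < s" "0 < s'" "rearr M f s' < \<tau>" "\<tau> < rearr M f s"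
  shows "distr_fun M f \<tau> \<in> {s..s'}"
proof -
  have "0 \<le> \<tau>" using rearr_nonneg[OF f_measurable \<open>0 < s'\<close>] assms(3) by simp
  then show ?thesis
    using rearr_le_iff[OF f_measurable _ \<open>0 < s\<close>, of \<tau>] rearr_le_iff[OF f_measurable _ \<open>0 < s'\<close>, of \<tau>] assms
    by auto
qed

text \<open>At levels strictly between the two values of the rearrangement the distribution function
  lies in [s, s'], so the integrand of the coarea inequality is at least \<open>m\<close> on that
  window.\<close>

lemma rearr_increment_le:
  assumes "0 < s" "s < s'" and m: "\<And>r. r \<in> {s..s'} \<Longrightarrow> m \<le> I r"
  shows "(rearr M f s - rearr M f s') * m
    \<le> (LINT x:{x. rearr M f s' < \<bar>f x\<bar>}|M. grad_mod f x) - (LINT x:{x. rearr M f s < \<bar>f x\<bar>}|M. grad_mod f x)"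
    (is "_ \<le> ?R")
proof (cases "0 \<le> m")
  \<comment> \<open>Negative \<open>m\<close> does occur: the bound is used with I s - e, and I s
    may be 0. Then only the signs matter.\<close>
  case False
  then have "(rearr M f s - rearr M f s') * m \<le> 0"
    using rearr_antimono[OF f_measurable, of s s'] assms by (intro mult_nonneg_nonpos) auto
  also have "0 \<le> ?R"
    using superlevel_integral_diff(1)[OF grad_mod_integrable, of s s'] assms by simp
  finally show ?thesis .
next
  case True
  have "0 < s'" using assms by simp
  have le: "rearr M f s' \<le> rearr M f s" using rearr_antimono[OF f_measurable, of s s'] assms by simp
  have "ennreal ((rearr M f s - rearr M f s') * m)
      = (\<integral>\<^sup>+\<tau>\<in>{rearr M f s'<..<rearr M f s}. ennreal m \<partial>lborel)"
    using le True by (simp add: nn_integral_cmult ennreal_mult mult.commute)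
  also have "\<dots> \<le> (\<integral>\<^sup>+\<tau>\<in>{rearr M f s'<..<rearr M f s}. ennreal (I (distr_fun M f \<tau>)) \<partial>lborel)"
    using m distr_fun_between[OF \<open>0 < s\<close> \<open>0 < s'\<close>]
    by (intro nn_integral_mono) (auto simp: indicator_def intro!: ennreal_leI)
  also have "\<dots> \<le> (\<integral>\<^sup>+x\<in>{x. rearr M f s' < \<bar>f x\<bar> \<and> \<bar>f x\<bar> \<le> rearr M f s}. ennreal (grad_mod f x) \<partial>M)"
    by (rule coarea_window[OF f])
  also have "\<dots> = ennreal ?R"
    using superlevel_integral_diff(2)[OF grad_mod_integrable _ \<open>0 < s\<close>, of s'] assms by simp
  finally show ?thesis
    using superlevel_integral_diff(1)[OF grad_mod_integrable _ \<open>0 < s\<close>, of s'] assms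
    by (subst (asm) ennreal_le_iff) auto
qed

lemma isCont_I: "s \<in> {0<..<1} \<Longrightarrow> isCont I s"
  using cont by (rule continuous_on_interior) (simp add: interior_atLeastAtMost_real)

lemma rearr_differentiable_AE: "AE s in lborel. s \<in> {0<..<1} \<longrightarrow> rearr M f differentiable (at s)"
proof -
  have "mono_on {0<..<1} (\<lambda>s. - rearr M f s)"
    using rearr_antimono[OF f_measurable] by (intro mono_onI) auto
  then have "AE s in lborel. s \<in> {0<..<1} \<longrightarrow> (\<lambda>s. - rearr M f s) differentiable (at s)"
    by (rule mono_on_differentiable_AE)
  moreover have "rearr M f differentiable (at s)" if "(\<lambda>s. - rearr M f s) differentiable (at s)" for s
    using differentiable_minus[OF that] by simp
  ultimately show ?thesis by (auto elim!: eventually_mono)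
qed

lemma superlevel_integral_differentiable_AE:
  fixes k :: "'a \<Rightarrow> real"
  assumes k: "integrable M k" "\<And>x. 0 \<le> k x"
  shows "AE s in lborel. s \<in> {0<..<1} \<longrightarrow> (\<lambda>s. LINT x:{x. rearr M f s < \<bar>f x\<bar>}|M. k x) differentiable (at s)"
  using superlevel_integral_diff(1)[OF k] by (intro mono_on_differentiable_AE mono_onI) auto

lemma deriv_rearr_mult_le:
  assumes "s \<in> {0<..<1}" "rearr M f differentiable (at s)"
    "(\<lambda>s. LINT x:{x. rearr M f s < \<bar>f x\<bar>}|M. grad_mod f x) differentiable (at s)"
  shows "- deriv (rearr M f) s * I s \<le> deriv (\<lambda>s. LINT x:{x. rearr M f s < \<bar>f x\<bar>}|M. grad_mod f x) s"
  using assms rearr_increment_le by (intro deriv_mult_le[where b = 1] isCont_I) auto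

text \<open>At \<open>s\<close> with \<open>\<lambda>\<^sub>f(f\<^sup>*(s)) < s\<close> the rearrangement is constant to the left of \<open>s\<close>.\<close>

lemma distr_fun_rearr_eq:
  assumes s: "0 < s" and diff: "rearr M f differentiable (at s)" and ne: "deriv (rearr M f) s \<noteq> 0"
  shows "distr_fun M f (rearr M f s) = s"
proof (rule ccontr)
  assume "distr_fun M f (rearr M f s) \<noteq> s"
  then have lt: "distr_fun M f (rearr M f s) < s" using distr_fun_rearr_le[OF f_measurable s] by simp
  define q where "q = distr_fun M f (rearr M f s)"
  have q: "0 \<le> q" "q < s" using lt by (auto simp: q_def)
  have const: "rearr M f r = rearr M f s" if "r \<in> {q<..<s}" for r
  proof (rule antisym)
    have "0 < r" "distr_fun M f (rearr M f s) \<le> r" using that q(1) by (auto simp: q_def[symmetric])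
    then show "rearr M f r \<le> rearr M f s"
      using rearr_le_iff[OF f_measurable rearr_nonneg[OF f_measurable s]] by blast
    show "rearr M f s \<le> rearr M f r" using rearr_antimono[OF f_measurable \<open>0 < r\<close>] that by auto
  qed
  have "(rearr M f has_real_derivative deriv (rearr M f) s) (at s)"
    using diff DERIV_deriv_iff_real_differentiable by blast
  then have "(rearr M f has_real_derivative deriv (rearr M f) s) (at s within {..<s})"
    by (rule has_field_derivative_at_within)
  moreover have "(rearr M f has_real_derivative 0) (at s within {..<s})"
  proof -
    have "((\<lambda>r. (rearr M f r - rearr M f s) / (r - s)) \<longlongrightarrow> 0) (at_left s)"
    proof (rule tendsto_eventually)
      show "eventually (\<lambda>r. (rearr M f r - rearr M f s) / (r - s) = 0) (at_left s)"
        using eventually_at_left_real[OF q(2)] by (rule eventually_mono) (simp add: const)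
    qed
    then show ?thesis by (simp add: has_field_derivative_iff)
  qed
  ultimately have "deriv (rearr M f) s = 0"
    unfolding has_field_derivative_iff by (rule tendsto_unique[rotated]) simp
  with ne show False by simp
qed

text \<open>The gradient is at most \<open>c\<close> plus its excess, so the increment bound holds
  with c r + \<Psi> r in place of the gradient integral, and differentiating leaves the excess term
  after subtracting \<open>c\<close>. Where the rearrangement has derivative 0 the left side is
  already 0.\<close>

lemma deriv_rearr_mult_le_excess:
  assumes s: "s \<in> {0<..<1}" and "0 \<le> c" and diff: "rearr M f differentiable (at s)"
    "(\<lambda>s. LINT x:{x. rearr M f s < \<bar>f x\<bar>}|M. max 0 (grad_mod f x - c)) differentiable (at s)"
  shows "ennreal (\<bar>- deriv (rearr M f) s * I s\<bar> - c)
    \<le> ennreal (deriv (\<lambda>s. LINT x:{x. rearr M f s < \<bar>f x\<bar>}|M. max 0 (grad_mod f x - c)) s)"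
proof (cases "deriv (rearr M f) s = 0")
  case True
  then show ?thesis using \<open>0 \<le> c\<close> by (simp add: ennreal_neg)
next
  case False
  define k where "k = (\<lambda>x. max 0 (grad_mod f x - c))"
  define \<Psi> where "\<Psi> = (\<lambda>s. LINT x:{x. rearr M f s < \<bar>f x\<bar>}|M. k x)"
  have k: "integrable M k" "\<And>x. 0 \<le> k x"
    unfolding k_def using grad_mod_integrable by (auto intro!: integrable_max)
  have \<Psi>diff: "\<Psi> differentiable (at s)" using diff(2) by (simp add: \<Psi>_def k_def)
  have N: "distr_fun M f (rearr M f s) = s"
    using distr_fun_rearr_eq[OF _ diff(1) False] s by simp
  have incr: "(rearr M f s - rearr M f s') * m \<le> (c * s' + \<Psi> s') - (c * s + \<Psi> s)"
    if s': "s < s'" "s' < 1" and m: "\<And>r. r \<in> {s..s'} \<Longrightarrow> m \<le> I r" for s' m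
  proof -
    let ?D = "{x. rearr M f s' < \<bar>f x\<bar> \<and> \<bar>f x\<bar> \<le> rearr M f s}"
    let ?R = "(LINT x:{x. rearr M f s' < \<bar>f x\<bar>}|M. grad_mod f x) - (LINT x:{x. rearr M f s < \<bar>f x\<bar>}|M. grad_mod f x)"
    have s0: "0 < s" "s \<le> s'" "0 < s'" using s s' by auto
    have sets: "{x. a < \<bar>f x\<bar>} \<in> sets M" "?D \<in> sets M" for a
      using measurable_sets[OF f_measurable, of "{x. a < \<bar>x\<bar>}"]
        measurable_sets[OF f_measurable, of "{x. rearr M f s' < \<bar>x\<bar> \<and> \<bar>x\<bar> \<le> rearr M f s}"]
      by (auto simp: vimage_def space_M)
    have "?D = {x. rearr M f s' < \<bar>f x\<bar>} - {x. rearr M f s < \<bar>f x\<bar>}" by auto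
    moreover have "{x. rearr M f s < \<bar>f x\<bar>} \<subseteq> {x. rearr M f s' < \<bar>f x\<bar>}"
      using rearr_antimono[OF f_measurable s0(1,2)] by auto
    ultimately have "measure M ?D = distr_fun M f (rearr M f s') - distr_fun M f (rearr M f s)"
      using sets(1) by (simp add: finite_measure_Diff distr_fun_def space_M)
    \<comment> \<open>Here \<open>N\<close> is essential: a value below \<open>s\<close> at the
      level \<open>rearr M f s\<close> would give only a bound larger than s' - s.\<close>
    then have D: "measure M ?D \<le> s' - s"
      using N distr_fun_rearr_le[OF f_measurable s0(3)] by simp
    have "ennreal ?R = (\<integral>\<^sup>+x\<in>?D. ennreal (grad_mod f x) \<partial>M)"
      by (rule superlevel_integral_diff(2)[OF grad_mod_integrable _ s0(1,2)]) simp
    also have "\<dots> \<le> (\<integral>\<^sup>+x. ennreal c * indicator ?D x + ennreal (k x) * indicator ?D x \<partial>M)"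
    proof (intro nn_integral_mono)
      fix x
      have "ennreal (grad_mod f x) \<le> ennreal (c + k x)" by (intro ennreal_leI) (simp add: k_def)
      then have "ennreal (grad_mod f x) \<le> ennreal c + ennreal (k x)" using \<open>0 \<le> c\<close> k(2) by simp
      then show "ennreal (grad_mod f x) * indicator ?D x \<le> ennreal c * indicator ?D x + ennreal (k x) * indicator ?D x"
        by (auto simp: indicator_def)
    qed
    also have "\<dots> = ennreal c * emeasure M ?D + (\<integral>\<^sup>+x\<in>?D. ennreal (k x) \<partial>M)"
      using sets(2) k(1) by (subst nn_integral_add) (auto simp: nn_integral_cmult)
    also have "\<dots> = ennreal (c * measure M ?D) + ennreal (\<Psi> s' - \<Psi> s)"
      using \<open>0 \<le> c\<close> superlevel_integral_diff(2)[OF k s0(1,2)]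
      by (simp add: \<Psi>_def emeasure_eq_measure ennreal_mult)
    also have "\<dots> \<le> ennreal (c * (s' - s)) + ennreal (\<Psi> s' - \<Psi> s)"
      using \<open>0 \<le> c\<close> D by (intro add_right_mono ennreal_leI mult_left_mono)
    also have "\<dots> = ennreal (c * (s' - s) + (\<Psi> s' - \<Psi> s))"
      using \<open>0 \<le> c\<close> s0 superlevel_integral_diff(1)[OF k s0(1,2)] by (simp add: \<Psi>_def ennreal_plus)
    finally have "?R \<le> c * (s' - s) + (\<Psi> s' - \<Psi> s)"
      using \<open>0 \<le> c\<close> s0 superlevel_integral_diff(1)[OF k s0(1,2)]
      by (subst (asm) ennreal_le_iff) (auto simp: \<Psi>_def)
    moreover have "(rearr M f s - rearr M f s') * m \<le> ?R" by (rule rearr_increment_le[OF s0(1) s'(1) m])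
    ultimately show ?thesis by (simp add: algebra_simps)
  qed
  have deriv: "((\<lambda>r. c * r + \<Psi> r) has_real_derivative c + deriv \<Psi> s) (at s)"
    using \<Psi>diff by (auto simp: DERIV_deriv_iff_real_differentiable intro!: derivative_eq_intros)
  then have "(\<lambda>r. c * r + \<Psi> r) differentiable (at s)" using real_differentiable_def by blast
  then have "- deriv (rearr M f) s * I s \<le> deriv (\<lambda>r. c * r + \<Psi> r) s"
    using s diff(1) incr by (intro deriv_mult_le[where b = 1] isCont_I) auto
  also have "\<dots> = c + deriv \<Psi> s" using deriv by (rule DERIV_imp_deriv)
  finally have "- deriv (rearr M f) s * I s - c \<le> deriv \<Psi> s" by simp
  \<comment> \<open>The absolute value stems from \<open>distr_fun\<close>, which measures level
    sets of |u|; since the rearrangement decreases and \<open>I\<close> is nonnegative, it changes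
    nothing.\<close>
  moreover have "deriv (rearr M f) s \<le> 0"
  proof (rule LIMSEQ_le_const2[OF deriv_quotient_tendsto[OF diff(1)]], intro exI allI impI)
    show "real (Suc n) * (rearr M f (s + 1 / Suc n) - rearr M f s) \<le> 0" for n
      using rearr_antimono[OF f_measurable, of s "s + 1 / real (Suc n)"] s
      by (intro mult_nonneg_nonpos) auto
  qed
  then have "\<bar>- deriv (rearr M f) s * I s\<bar> = - deriv (rearr M f) s * I s"
    using I_nonneg[of s] s by (simp add: mult_nonpos_nonneg)
  ultimately show ?thesis by (simp add: \<Psi>_def k_def ennreal_leI)
qed

end

section \<open>The four inequalities\<close>

lemma derivative_ineq: "derivative_ineq M I"
  unfolding derivative_ineq_def Let_def
proof
  fix f :: "'a \<Rightarrow> real" assume f: "f \<in> Lip"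
  have "AE s in lborel. s \<in> {0<..<1}
      \<longrightarrow> (\<lambda>s. LINT x:{x. rearr M f s < \<bar>f x\<bar>}|M. grad_mod f x) differentiable (at s)"
    by (rule superlevel_integral_differentiable_AE[OF f grad_mod_integrable[OF f]]) simp
  then show "AE s in lborel. s \<in> {0<..<1} \<longrightarrow> rearr M f differentiable (at s)
      \<and> (\<lambda>r. LINT x:{x. rearr M f r < \<bar>f x\<bar>}|M. grad_mod f x) differentiable (at s)
      \<and> - deriv (rearr M f) s * I s \<le> deriv (\<lambda>r. LINT x:{x. rearr M f r < \<bar>f x\<bar>}|M. grad_mod f x) s"
    using rearr_differentiable_AE[OF f]
    by eventually_elim (use deriv_rearr_mult_le[OF f] in blast)
qed

lemma coarea_ineq: "coarea_ineq M I"
  unfolding coarea_ineq_def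
proof
  fix f :: "'a \<Rightarrow> real" assume f: "f \<in> Lip"
  have "(\<integral>\<^sup>+s\<in>{0<..}. ennreal (I (distr_fun M f s)) \<partial>lborel)
      \<le> (\<integral>\<^sup>+x\<in>{x. 0 < \<bar>f x\<bar>}. ennreal (grad_mod f x) \<partial>M)"
    by (rule coarea_above[OF f])
  also have "\<dots> \<le> (\<integral>\<^sup>+x. ennreal (grad_mod f x) \<partial>M)"
    by (intro nn_integral_mono) (auto simp: indicator_def)
  finally show "(\<integral>\<^sup>+s\<in>{0<..}. ennreal (I (distr_fun M f s)) \<partial>lborel)
      \<le> (\<integral>\<^sup>+x. ennreal (grad_mod f x) \<partial>M)" .
qed

lemma rearrangement_ineq: "rearrangement_ineq M I"
  unfolding rearrangement_ineq_def
proof (intro ballI)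
  fix f :: "'a \<Rightarrow> real" and t :: real assume f: "f \<in> Lip" and t: "t \<in> {0<..<1}"
  note [measurable] = Lip_measurable[OF f] grad_mod_measurable_M[OF f]
  let ?N = "lebesgue_on {0<..<1::real}"
  define g where "g = (\<lambda>r. - deriv (rearr M f) r * I r)"
  \<comment> \<open>At this level the bound by excess is an equality for the gradient; for the
    left-hand function any nonnegative level is admissible, so the terms \<open>c * t\<close> agree
    on both sides.\<close>
  define c where "c = rearr M (grad_mod f) t"
  have "0 \<le> c" unfolding c_def using t by (intro rearr_nonneg) auto
  define k where "k = (\<lambda>x. max 0 (grad_mod f x - c))"
  have k: "integrable M k" "\<And>x. 0 \<le> k x"
    unfolding k_def using grad_mod_integrable[OF f] by (auto intro!: integrable_max)
  define \<Psi> where "\<Psi> = (\<lambda>s. LINT x:{x. rearr M f s < \<bar>f x\<bar>}|M. k x)"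
  have \<Psi>diff: "AE s in lborel. s \<in> {0<..<1} \<longrightarrow> \<Psi> differentiable (at s)"
    unfolding \<Psi>_def by (rule superlevel_integral_differentiable_AE[OF f k])
  interpret N: finite_measure ?N
    by (intro finite_measureI) (simp add: emeasure_restrict_space)
  have g: "g \<in> borel_measurable ?N"
  proof -
    have "deriv (rearr M f) \<in> borel_measurable ?N"
      using rearr_measurable[OF Lip_measurable[OF f]] rearr_differentiable_AE[OF f]
      by (rule deriv_measurable_lebesgue_on)
    moreover have "I \<in> borel_measurable ?N"
      by (rule continuous_imp_measurable_on_sets_lebesgue[OF continuous_on_subset[OF cont]]) auto
    ultimately show ?thesis unfolding g_def by measurable
  qed
  have "(\<integral>\<^sup>+s\<in>{0<..<t}. ennreal (rearr ?N g s) \<partial>lborel)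
      \<le> ennreal (c * t) + (\<integral>\<^sup>+x. ennreal (\<bar>g x\<bar> - c) \<partial>?N)"
    using N.nn_integral_rearr_le[OF g \<open>0 \<le> c\<close>] t by simp
  also have "(\<integral>\<^sup>+x. ennreal (\<bar>g x\<bar> - c) \<partial>?N) = (\<integral>\<^sup>+x\<in>{0<..<1}. ennreal (\<bar>g x\<bar> - c) \<partial>lborel)"
    by (simp add: nn_integral_restrict_space nn_integral_completion)
  also have "\<dots> \<le> (\<integral>\<^sup>+x\<in>{0<..<1}. ennreal (deriv \<Psi> x) \<partial>lborel)"
  proof (rule nn_integral_mono_AE)
    show "AE s in lborel. ennreal (\<bar>g s\<bar> - c) * indicator {0<..<1} s \<le> ennreal (deriv \<Psi> s) * indicator {0<..<1} s"
      using rearr_differentiable_AE[OF f] \<Psi>diff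
    proof eventually_elim
      case (elim s)
      then show ?case
        using deriv_rearr_mult_le_excess[OF f _ \<open>0 \<le> c\<close>, of s]
        by (auto simp: indicator_def g_def \<Psi>_def k_def)
    qed
  qed
  \<comment> \<open>The function \<Psi> increases within [0, \<open>LINT x|M. k x\<close>], so the
    integral of its derivative over (0,1) is at most the total excess of the gradient.\<close>
  also have "\<dots> \<le> ennreal (LINT x|M. k x)"
  proof (rule nn_integral_deriv_mono_on_le[OF _ _ _ \<Psi>diff])
    show "mono_on {0<..<1} \<Psi>"
      unfolding \<Psi>_def using superlevel_integral_diff(1)[OF f k] by (intro mono_onI) auto
    show "0 \<le> \<Psi> s \<and> \<Psi> s \<le> (LINT x|M. k x)" for s
    proof -
      have "{x. rearr M f s < \<bar>f x\<bar>} \<in> sets M"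
        using measurable_sets[OF Lip_measurable[OF f], of "{x. rearr M f s < \<bar>x\<bar>}"]
        by (auto simp: vimage_def space_M)
      then have "integrable M (\<lambda>x. indicator {x. rearr M f s < \<bar>f x\<bar>} x *\<^sub>R k x)"
        using k(1) by (rule integrable_mult_indicator)
      then show ?thesis
        unfolding \<Psi>_def set_lebesgue_integral_def using k
        by (intro conjI integral_nonneg_AE integral_mono) (auto simp: indicator_def)
    qed
  qed simp
  also have "ennreal (LINT x|M. k x) = (\<integral>\<^sup>+x. ennreal (\<bar>grad_mod f x\<bar> - c) \<partial>M)"
    using k by (subst nn_integral_eq_integral[symmetric])
      (auto simp: k_def max_def ennreal_neg intro!: nn_integral_cong)
  also have "ennreal (c * t) + (\<integral>\<^sup>+x. ennreal (\<bar>grad_mod f x\<bar> - c) \<partial>M)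
      = (\<integral>\<^sup>+s\<in>{0<..<t}. ennreal (rearr M (grad_mod f) s) \<partial>lborel)"
    unfolding c_def using t by (subst nn_integral_rearr_eq) auto
  finally show "(\<integral>\<^sup>+s\<in>{0<..<t}. ennreal (rearr ?N (\<lambda>r. - deriv (rearr M f) r * I r) s) \<partial>lborel)
      \<le> (\<integral>\<^sup>+s\<in>{0<..<t}. ennreal (rearr M (grad_mod f) s) \<partial>lborel)"
    by (simp add: g_def add_left_mono)
qed

text \<open>The point \<open>r\<close> is the convex combination of 0 and \<open>t\<close> with
  weight r / t, and the term with I 0 \<ge> 0 is dropped. The cross-multiplied form includes r =
  0.\<close>

lemma concave_ratio_le:
  assumes "concave_on {0..1} I" "r \<in> {0..t}" "0 < t" "t \<le> 1"
  shows "r * I t \<le> t * I r"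
proof -
  define a where "a = r / t"
  have a: "0 \<le> a" "a \<le> 1" "r = a * t" using assms by (auto simp: a_def)
  have "(1 - a) * I 0 + a * I t \<le> I ((1 - a) *\<^sub>R 0 + a *\<^sub>R t)"
    using assms a by (intro concave_onD) auto
  moreover have "0 \<le> (1 - a) * I 0" using a I_nonneg[of 0] by simp
  ultimately have "a * I t \<le> I r" using a by simp
  then have "t * (a * I t) \<le> t * I r" using assms(3) by (intro mult_left_mono) auto
  then show ?thesis using a(3) by (simp add: mult_ac)
qed

lemma oscillation_ineq:
  assumes "concave_on {0..1} I"
  shows "oscillation_ineq M I"
  unfolding oscillation_ineq_def
proof (intro ballI impI)
  fix f :: "'a \<Rightarrow> real" and t :: real assume f: "f \<in> Lip" and t: "t \<in> {0<..<1}" and "I t \<noteq> 0"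
  note [measurable] = Lip_measurable[OF f] grad_mod_measurable_M[OF f]
    I_distr_fun_measurable[OF Lip_measurable[OF f]]
  have It: "0 < I t" using I_nonneg[of t] \<open>I t \<noteq> 0\<close> t by auto
  define c where "c = rearr M f t"
  have "0 \<le> c" unfolding c_def using t by (intro rearr_nonneg) auto
  \<comment> \<open>Since \<open>c\<close> is the rearrangement at \<open>t\<close>, the oscillation
    on the left of (iv) is exactly \<open>X / ennreal t\<close>.\<close>
  define X where "X = (\<integral>\<^sup>+x. ennreal (\<bar>f x\<bar> - c) \<partial>M)"
  have small: "distr_fun M f \<tau> \<le> t" if "c \<le> \<tau>" for \<tau>
    using distr_fun_rearr_le[of f t] distr_fun_antimono[of f c \<tau>] that t by (simp add: c_def)
  have "X = (\<integral>\<^sup>+\<tau>\<in>{c<..}. ennreal (distr_fun M f \<tau>) \<partial>lborel)"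
    unfolding X_def by (rule distr_fun_layer_cake) measurable
  also have "\<dots> \<le> (\<integral>\<^sup>+\<tau>. ennreal (t / I t) * (ennreal (I (distr_fun M f \<tau>)) * indicator {c<..} \<tau>) \<partial>lborel)"
  proof (intro nn_integral_mono)
    fix \<tau>
    have "ennreal (distr_fun M f \<tau>) \<le> ennreal (t / I t) * ennreal (I (distr_fun M f \<tau>))" if "c < \<tau>"
    proof -
      have "distr_fun M f \<tau> * I t \<le> t * I (distr_fun M f \<tau>)"
        using concave_ratio_le[OF assms, of "distr_fun M f \<tau>" t] small[of \<tau>] that t by simp
      then have "distr_fun M f \<tau> \<le> t / I t * I (distr_fun M f \<tau>)" using It by (simp add: field_simps)
      then show ?thesis
        using It t I_nonneg[OF distr_fun_range] by (simp add: ennreal_mult[symmetric] ennreal_leI)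
    qed
    then show "ennreal (distr_fun M f \<tau>) * indicator {c<..} \<tau>
      \<le> ennreal (t / I t) * (ennreal (I (distr_fun M f \<tau>)) * indicator {c<..} \<tau>)"
      by (auto simp: indicator_def)
  qed
  also have "\<dots> = ennreal (t / I t) * (\<integral>\<^sup>+\<tau>\<in>{c<..}. ennreal (I (distr_fun M f \<tau>)) \<partial>lborel)"
    by (rule nn_integral_cmult) measurable
  also have "\<dots> \<le> ennreal (t / I t) * (\<integral>\<^sup>+x\<in>{x. c < \<bar>f x\<bar>}. ennreal (grad_mod f x) \<partial>M)"
    by (intro mult_left_mono coarea_above[OF f]) simp
  \<comment> \<open>The coarea inequality is taken above level \<open>c\<close> only, so the
    gradient is integrated over a set of measure at most \<open>t\<close>, as the Hardy-Littlewood
    bound demands.\<close>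
  also have "(\<integral>\<^sup>+x\<in>{x. c < \<bar>f x\<bar>}. ennreal (grad_mod f x) \<partial>M)
      \<le> (\<integral>\<^sup>+s\<in>{0<..<t}. ennreal (rearr M (grad_mod f) s) \<partial>lborel)"
  proof -
    have "{x. c < \<bar>f x\<bar>} \<in> sets M"
      using measurable_sets[OF Lip_measurable[OF f], of "{x. c < \<bar>x\<bar>}"] by (auto simp: vimage_def space_M)
    moreover have "measure M {x. c < \<bar>f x\<bar>} \<le> t" using small[of c] by (simp add: distr_fun_def space_M)
    ultimately show ?thesis
      using nn_integral_set_le_rearr[of "grad_mod f" "{x. c < \<bar>f x\<bar>}" t] t by simp
  qed
  finally have X: "X \<le> ennreal (t / I t) * (\<integral>\<^sup>+s\<in>{0<..<t}. ennreal (rearr M (grad_mod f) s) \<partial>lborel)"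
    by (simp add: mult_left_mono)
  have "rearr_avg M f t = (ennreal (c * t) + X) / ennreal t"
    unfolding rearr_avg_def X_def c_def using t by (subst nn_integral_rearr_eq) auto
  also have "\<dots> = ennreal c + X / ennreal t"
    using t \<open>0 \<le> c\<close> by (simp add: add_divide_distrib_ennreal divide_ennreal)
  finally have "rearr_avg M f t - ennreal c = X / ennreal t" by simp
  also have "\<dots> \<le> ennreal (t / I t) * (\<integral>\<^sup>+s\<in>{0<..<t}. ennreal (rearr M (grad_mod f) s) \<partial>lborel) / ennreal t"
    using X by (rule divide_right_mono_ennreal)
  also have "\<dots> = ennreal (t / I t) * rearr_avg M (grad_mod f) t"
    by (simp add: rearr_avg_def ennreal_times_divide)
  finally show "rearr_avg M f t - ennreal (rearr M f t) \<le> ennreal (t / I t) * rearr_avg M (grad_mod f) t"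
    by (simp add: c_def)
qed

end

theorem theorem1:
  fixes M :: "'a::metric_space measure" and I :: "real \<Rightarrow> real"
  assumes "prob_space M" and "sets M = sets borel" and "separable_measure M"
    and "is_isoperimetric_profile M I"
    and "concave_on {0..1} I" and "continuous_on {0..1} I"
    and "mono_on {0<..<1/2} I" and "\<And>t. t \<in> {0..1} \<Longrightarrow> I (1 - t) = I t"
  shows "(coarea_ineq M I \<and> derivative_ineq M I \<and> rearrangement_ineq M I \<and> oscillation_ineq M I) \<and>
    (coarea_ineq M I \<longleftrightarrow> derivative_ineq M I) \<and>
    (derivative_ineq M I \<longleftrightarrow> rearrangement_ineq M I) \<and>
    (rearrangement_ineq M I \<longleftrightarrow> oscillation_ineq M I)"
proof -
  interpret prob_space M by fact
  interpret isoperimetric_space M I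
    by unfold_locales (use assms in \<open>auto simp: is_isoperimetric_profile_def\<close>)
  show ?thesis
    using coarea_ineq derivative_ineq rearrangement_ineq oscillation_ineq[OF assms(5)] by simp
qed

end
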